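(* Let $G$ be a finitely generated group. Suppose there exists a (possibly infinite) generating set $S$ of $G$ of cardinality at least two such that every element of $S$ has infinite order and the commutativity graph $K(G,S)$ is connected. Suppose further that there exist adjacent vertices $s, s'$ of $K(G,S)$ and non-zero integers $n_s, n_{s'}$ such that $\langle s^{n_s}, (s')^{n_{s'}}\rangle$ is abelian of rank $2$. Then $G$ is not strongly hyperbolic relative to any finite collection of proper finitely generated subgroups.
   Context: Commutativity graph: let $G$ be a group and $S$ a (possibly infinite) generating set for $G$, all of whose elements have infinite order. The commutativity graph $K(G,S)$ is the simplicial graph with vertex set $S$ in which distinct vertices $s,s'$ are joined by an edge if and only if there are non-zero integers $n_s,n_{s'}$ such that the subgroup $\langle s^{n_s},(s')^{n_{s'}}\rangle$ of $G$ is abelian. Rank: the rank of a finitely generated abelian group $A$ is the rank of some (equivalently every) free abelian subgroup of finite index in $A$. Strong relative hyperbolicity: a group $G$ is strongly hyperbolic relative to a family $L_1,\dots,L_m$ ($m\ge 1$) of proper finitely generated subgroups if $G$ admits an action on a connected graph $\mathcal{G}$ such that: $\mathcal{G}$ (with all edges of length one) is hyperbolic in the sense of Gromov; $\mathcal{G}$ is fine, i.e. for each $n\in\mathbf{N}$ each edge of $\mathcal{G}$ belongs to only finitely many circuits (closed edge paths without repeated vertices) of length $n$; there are only finitely many $G$-orbits of edges; each edge stabiliser is finite; and the stabilisers of the vertices of infinite valence are precisely the conjugates of the $L_j$. *)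

theory Defs
  imports
    Complex_Main
    "HOL-Algebra.Group_Action"
    "HOL-Algebra.Generated_Groups"
    "HOL-Algebra.Multiplicative_Group"
    "HOL-Algebra.Free_Abelian_Groups"
begin

section \<open>Graphs\<close>

text \<open>
  Graphs are simplicial, i.e. undirected without loops or multiple edges, and may be infinite.
  An edge is the two-element set of its endpoints.
\<close>

definition simplicial_graph :: "'v set \<Rightarrow> 'v set set \<Rightarrow> bool" where
  "simplicial_graph V E \<longleftrightarrow> (\<forall>e\<in>E. e \<subseteq> V \<and> card e = 2)"

definition walk_between :: "'v set \<Rightarrow> 'v set set \<Rightarrow> 'v \<Rightarrow> 'v list \<Rightarrow> 'v \<Rightarrow> bool" where
  "walk_between V E u xs v \<longleftrightarrow>
     xs \<noteq> [] \<and> set xs \<subseteq> V \<and> hd xs = u \<and> last xs = v \<and> successively (\<lambda>x y. {x, y} \<in> E) xs"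

definition connected_graph :: "'v set \<Rightarrow> 'v set set \<Rightarrow> bool" where
  "connected_graph V E \<longleftrightarrow>
     simplicial_graph V E \<and> V \<noteq> {} \<and> (\<forall>u\<in>V. \<forall>v\<in>V. \<exists>xs. walk_between V E u xs v)"

definition graph_dist :: "'v set \<Rightarrow> 'v set set \<Rightarrow> 'v \<Rightarrow> 'v \<Rightarrow> nat" where
  "graph_dist V E u v = (LEAST n. \<exists>xs. walk_between V E u xs v \<and> length xs = Suc n)"

subsection \<open>Hyperbolicity\<close>

text \<open>
  The geometric realisation of a graph, in barycentric coordinates: a point is a function with
  non-negative values adding up to 1 whose support is a vertex or (the endpoints of) an edge.
\<close>

definition supp :: "('v \<Rightarrow> real) \<Rightarrow> 'v set" where
  "supp p = {v. p v \<noteq> 0}"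

definition cells :: "'v set \<Rightarrow> 'v set set \<Rightarrow> 'v set set" where
  "cells V E = {{v} | v. v \<in> V} \<union> E"

definition realisation :: "'v set \<Rightarrow> 'v set set \<Rightarrow> ('v \<Rightarrow> real) set" where
  "realisation V E = {p. supp p \<in> cells V E \<and> (\<forall>v. 0 \<le> p v) \<and> sum p (supp p) = 1}"

text \<open>
  The path metric for which every edge is isometric to the unit interval. Two points of a common
  edge {a, b} have distance |p a - q a| = |p b - q b|, which is half of the sum below. For other
  points, a shortest path leaves the cell of p through an endpoint a, at distance 1 - p a from p,
  and enters the cell of q through an endpoint b, at distance 1 - q b from q.
\<close>

definition realisation_dist ::
    "'v set \<Rightarrow> 'v set set \<Rightarrow> ('v \<Rightarrow> real) \<Rightarrow> ('v \<Rightarrow> real) \<Rightarrow> real" where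
  "realisation_dist V E p q =
     (if \<exists>c\<in>cells V E. supp p \<union> supp q \<subseteq> c
      then (\<Sum>v\<in>supp p \<union> supp q. \<bar>p v - q v\<bar>) / 2
      else Min {(1 - p a) + real (graph_dist V E a b) + (1 - q b) | a b. a \<in> supp p \<and> b \<in> supp q})"

definition gromov_product :: "('p \<Rightarrow> 'p \<Rightarrow> real) \<Rightarrow> 'p \<Rightarrow> 'p \<Rightarrow> 'p \<Rightarrow> real" where
  "gromov_product d x y w = (d x w + d y w - d x y) / 2"

definition gromov_hyperbolic :: "'p set \<Rightarrow> ('p \<Rightarrow> 'p \<Rightarrow> real) \<Rightarrow> bool" where
  "gromov_hyperbolic X d \<longleftrightarrow>
     (\<exists>\<delta>\<ge>0. \<forall>x\<in>X. \<forall>y\<in>X. \<forall>z\<in>X. \<forall>w\<in>X.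
        min (gromov_product d x y w) (gromov_product d y z w) - \<delta> \<le> gromov_product d x z w)"

definition hyperbolic_graph :: "'v set \<Rightarrow> 'v set set \<Rightarrow> bool" where
  "hyperbolic_graph V E \<longleftrightarrow> gromov_hyperbolic (realisation V E) (realisation_dist V E)"

subsection \<open>Fineness\<close>

text \<open>
  A circuit of length n is given by the list of its n distinct vertices, with the last vertex
  adjacent to the first one. The 2n lists obtained by moving the base point or
  reversing the direction represent the same circuit, which does not affect finiteness.
\<close>

definition circuit_edges :: "'v list \<Rightarrow> 'v set set" where
  "circuit_edges xs = {{xs ! i, xs ! (Suc i mod length xs)} | i. i < length xs}"

definition is_circuit :: "'v set set \<Rightarrow> 'v list \<Rightarrow> bool" where
  "is_circuit E xs \<longleftrightarrow> 3 \<le> length xs \<and> distinct xs \<and> circuit_edges xs \<subseteq> E"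

definition fine_graph :: "'v set set \<Rightarrow> bool" where
  "fine_graph E \<longleftrightarrow>
     (\<forall>n. \<forall>e\<in>E. finite {xs. is_circuit E xs \<and> length xs = n \<and> e \<in> circuit_edges xs})"

definition infinite_valence :: "'v set set \<Rightarrow> 'v \<Rightarrow> bool" where
  "infinite_valence E v \<longleftrightarrow> infinite {e \<in> E. v \<in> e}"

section \<open>Groups\<close>

definition generates :: "('a, 'b) monoid_scheme \<Rightarrow> 'a set \<Rightarrow> 'a set \<Rightarrow> bool" where
  "generates G T H \<longleftrightarrow> T \<subseteq> carrier G \<and> generate G T = H"

definition has_rank :: "('a, 'b) monoid_scheme \<Rightarrow> nat \<Rightarrow> bool" where
  "has_rank A n \<longleftrightarrow>
     (\<exists>B. subgroup B A \<and> finite (rcosets\<^bsub>A\<^esub> B) \<and>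
          A\<lparr>carrier := B\<rparr> \<cong> free_Abelian_group {..<n})"

text \<open>
  The commutativity graph of a group with respect to S has vertex set S and the following edges.
\<close>

definition commutativity_edges :: "('a, 'b) monoid_scheme \<Rightarrow> 'a set \<Rightarrow> 'a set set" where
  "commutativity_edges G S =
     {{s, t} | s t. s \<in> S \<and> t \<in> S \<and> s \<noteq> t \<and>
        (\<exists>(m::int) (n::int). m \<noteq> 0 \<and> n \<noteq> 0 \<and>
           comm_group (subgroup_generated G {s [^]\<^bsub>G\<^esub> m, t [^]\<^bsub>G\<^esub> n}))}"

section \<open>Strong relative hyperbolicity\<close>

definition acts_on_graph ::
    "('a, 'b) monoid_scheme \<Rightarrow> 'v set \<Rightarrow> 'v set set \<Rightarrow> ('a \<Rightarrow> 'v \<Rightarrow> 'v) \<Rightarrow> bool" where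
  "acts_on_graph G V E \<phi> \<longleftrightarrow>
     group_action G V \<phi> \<and> (\<forall>g\<in>carrier G. \<forall>e\<in>E. \<phi> g ` e \<in> E)"

abbreviation edge_action :: "('a \<Rightarrow> 'v \<Rightarrow> 'v) \<Rightarrow> 'a \<Rightarrow> 'v set \<Rightarrow> 'v set" where
  "edge_action \<phi> \<equiv> \<lambda>g e. \<phi> g ` e"

text \<open>
  The definition asks for a graph with vertices in the type \<open>'v\<close>. To deny strong relative
  hyperbolicity is to deny this property for all types \<open>'v\<close>, so negative statements have to leave
  \<open>'v\<close> a type variable.
\<close>

definition strongly_hyperbolic_relative ::
    "'v itself \<Rightarrow> ('a, 'b) monoid_scheme \<Rightarrow> 'a set set \<Rightarrow> bool" where
  "strongly_hyperbolic_relative (_ :: 'v itself) G \<L> \<longleftrightarrow>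
     finite \<L> \<and> \<L> \<noteq> {} \<and>
     (\<forall>L\<in>\<L>. subgroup L G \<and> L \<noteq> carrier G \<and> (\<exists>T. finite T \<and> generates G T L)) \<and>
     (\<exists>(V :: 'v set) E \<phi>.
        connected_graph V E \<and> acts_on_graph G V E \<phi> \<and>
        hyperbolic_graph V E \<and>
        fine_graph E \<and>
        finite (orbits G E (edge_action \<phi>)) \<and>
        (\<forall>e\<in>E. finite (stabilizer G (edge_action \<phi>) e)) \<and>
        {stabilizer G \<phi> v | v. v \<in> V \<and> infinite_valence E v} =
          {g <#\<^bsub>G\<^esub> L #>\<^bsub>G\<^esub> inv\<^bsub>G\<^esub> g | g L. g \<in> carrier G \<and> L \<in> \<L>})"

end

theory Submission
  imports Defs
begin

text \<open>
  An element of infinite order fixes at most one vertex, because the graph is fine and its edges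
  have finite stabilisers. So if \<open>s\<close> fixes \<open>v\<close> and powers of \<open>s\<close> and \<open>t\<close> commute,
  then \<open>t\<close> fixes \<open>v\<close> as well. As the commutativity graph is connected, it is enough that some
  non-trivial element of the abelian subgroup of rank 2 fixes a vertex: then \<open>G\<close> is the
  stabiliser of a vertex of infinite valence, and hence conjugate to one of the proper subgroups.

  Suppose that no non-trivial element of the subgroup \<open>A\<close> of rank 2 fixes a vertex. Then orbit
  maps of \<open>A\<close> are proper by fineness. Let \<open>g\<close> in \<open>A\<close> move a vertex \<open>x\<close> very far. Every
  \<open>h\<close> in \<open>A\<close> that moves \<open>x\<close> by at most \<open>C\<close> moves \<open>g x\<close> by at most \<open>C\<close> too, so that by
  hyperbolicity \<open>h\<close> maps a geodesic from \<open>x\<close> to \<open>g x\<close> to one that is uniformly close to it,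
  away from the ends. Closing up the two geodesics, fineness confines the image under \<open>h\<close> of one
  of \<open>O(C)\<close> edges to a uniformly finite set. So there are only \<open>O(C)\<close> such \<open>h\<close>, whereas a
  group of rank 2 has quadratic growth.
\<close>

section \<open>Walks and circuits\<close>

text \<open>Bounding the number of steps makes estimates add up under concatenation. The relation is
  a parameter so that walks can be confined to a ball, to chosen edges or away from a
  vertex.\<close>

definition reach :: "('v \<Rightarrow> 'v \<Rightarrow> bool) \<Rightarrow> nat \<Rightarrow> 'v \<Rightarrow> 'v \<Rightarrow> bool" where
  "reach R n x y \<longleftrightarrow> (\<exists>k\<le>n. (R ^^ k) x y)"

lemma reach_refl: "reach R n x x"
  unfolding reach_def by (metis le0 relpowp_0_I)

lemma reach_step: "R x y \<Longrightarrow> reach R 1 x y"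
  unfolding reach_def by (metis order_refl relpowp_1)

lemma reach_trans: "reach R m x y \<Longrightarrow> reach R n y z \<Longrightarrow> reach R (m + n) x z"
proof -
  assume "reach R m x y" "reach R n y z"
  then obtain k l where "k \<le> m" "(R ^^ k) x y" "l \<le> n" "(R ^^ l) y z"
    unfolding reach_def by blast
  then have "k + l \<le> m + n" "(R ^^ (k + l)) x z"
    by (auto intro: relpowp_trans)
  then show ?thesis unfolding reach_def by blast
qed

lemma reach_mono:
  assumes "reach R m x y" "m \<le> n" "\<And>p q. R p q \<Longrightarrow> R' p q"
  shows "reach R' n x y"
proof -
  obtain k where k: "k \<le> m" "(R ^^ k) x y"
    using assms(1) unfolding reach_def by blast
  then have "k \<le> n" "(R' ^^ k) x y"
    using assms(2) relpowp_mono[OF assms(3)] by auto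
  then show ?thesis unfolding reach_def by blast
qed

lemma relpowp_sym:
  assumes "\<And>p q. R p q \<Longrightarrow> R q p" "(R ^^ k) x y"
  shows "(R ^^ k) y x"
  using assms(2)
proof (induction k arbitrary: y)
  case (Suc k)
  then obtain z where "(R ^^ k) x z" "R z y" by auto
  then show ?case
    using Suc.IH assms(1) by (blast intro: relpowp_Suc_I2)
qed auto

lemma reach_sym:
  assumes "reach R n x y" "\<And>p q. R p q \<Longrightarrow> R q p"
  shows "reach R n y x"
  using assms(1) relpowp_sym[of R, OF assms(2)] unfolding reach_def by blast

lemma relpowp_map:
  assumes "\<And>p q. R p q \<Longrightarrow> R' (f p) (f q)" "(R ^^ k) x y"
  shows "(R' ^^ k) (f x) (f y)"
  using assms(2)
proof (induction k arbitrary: y)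
  case (Suc k)
  then obtain z where "(R ^^ k) x z" "R z y" by auto
  then show ?case
    using Suc.IH assms(1) by (blast intro: relpowp_Suc_I)
qed auto

lemma reach_map:
  assumes "reach R n x y" "\<And>p q. R p q \<Longrightarrow> R' (f p) (f q)"
  shows "reach R' n (f x) (f y)"
  using assms(1) relpowp_map[of R R' f, OF assms(2)] unfolding reach_def by blast

lemma relpowp_along:
  assumes "\<And>i. i < k \<Longrightarrow> R (f (a + i)) (f (a + Suc i))"
  shows "(R ^^ k) (f a) (f (a + k))"
  using assms by (subst relpowp_fun_conv) (intro exI[of _ "\<lambda>i. f (a + i)"], auto)

text \<open>The last two hypotheses say that \<open>a\<close> and \<open>b\<close> differ by at most
  \<open>n\<close>. Only steps with index below \<open>m\<close> occur, which later limits the edges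
  that a walk uses.\<close>

lemma reach_along:
  assumes "\<And>i. i < m \<Longrightarrow> R (f i) (f (Suc i))" "\<And>p q. R p q \<Longrightarrow> R q p"
    and "a \<le> m" "b \<le> m" "a \<le> b + n" "b \<le> a + n"
  shows "reach R n (f a) (f b)"
proof -
  have forward: "reach R n (f i) (f j)" if "i \<le> j" "j \<le> m" "j \<le> i + n" for i j
    using relpowp_along[of "j - i" R f i] assms(1) that
    unfolding reach_def by (intro exI[of _ "j - i"]) auto
  show ?thesis
    using assms by (cases "a \<le> b") (auto intro: forward reach_sym[OF forward])
qed

lemma relpowp_avoids_or_meets:
  assumes "(R ^^ k) x y" "x \<noteq> t"
  shows "((\<lambda>p q. R p q \<and> p \<noteq> t \<and> q \<noteq> t) ^^ k) x y \<or> (\<exists>l\<le>k. (R ^^ l) x t)"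
  using assms(1)
proof (induction k arbitrary: y)
  case (Suc k)
  then obtain z where z: "(R ^^ k) x z" "R z y" by auto
  show ?case
  proof (cases "\<exists>l\<le>Suc k. (R ^^ l) x t")
    case False
    then have "z \<noteq> t" "y \<noteq> t"
      using z(1) Suc.prems le_Suc_eq by blast+
    moreover have "((\<lambda>p q. R p q \<and> p \<noteq> t \<and> q \<noteq> t) ^^ k) x z"
      using Suc.IH[OF z(1)] False le_SucI by blast
    ultimately show ?thesis
      using z(2) by auto
  qed blast
qed auto

text \<open>Loop erasure: if the new start \<open>x\<close> already lies on the path, everything
  before that occurrence is cut off.\<close>

lemma relpowp_imp_distinct_path:
  assumes "(R ^^ k) x y"
  shows "\<exists>ys. ys \<noteq> [] \<and> distinct ys \<and> hd ys = x \<and> last ys = y \<and> length ys \<le> Suc k \<and> successively R ys"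
  using assms
proof (induction k arbitrary: x)
  case 0
  then show ?case by (intro exI[of _ "[y]"]) auto
next
  case (Suc k)
  then obtain z where z: "R x z" "(R ^^ k) z y"
    by (meson relpowp_Suc_E2)
  obtain ys where ys: "ys \<noteq> []" "distinct ys" "hd ys = z" "last ys = y" "length ys \<le> Suc k"
      "successively R ys"
    using Suc.IH[OF z(2)] by blast
  show ?case
  proof (cases "x \<in> set ys")
    case True
    then obtain us vs where "ys = us @ x # vs"
      by (meson split_list)
    then show ?thesis
      using ys by (intro exI[of _ "x # vs"]) (auto simp: successively_append_iff)
  next
    case False
    then show ?thesis
      using ys z(1) by (intro exI[of _ "x # ys"]) (auto simp: successively_Cons)
  qed
qed

section \<open>Short circuits through a given edge\<close>

lemma path_closes_to_circuit:
  assumes e: "{u, w} \<in> E" "u \<noteq> w"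
    and ys: "distinct ys" "ys \<noteq> []" "hd ys = u" "last ys = w"
    and R: "successively R ys" "\<And>p q. R p q \<Longrightarrow> {p, q} \<in> E - {{u, w}}"
  shows "is_circuit E ys" "{u, w} \<in> circuit_edges ys"
    "\<And>i. Suc i < length ys \<Longrightarrow> {ys ! i, ys ! Suc i} \<in> circuit_edges ys"
proof -
  have hd: "ys ! 0 = u" and last: "ys ! (length ys - 1) = w"
    using ys by (auto simp: hd_conv_nth last_conv_nth)
  have step: "{ys ! i, ys ! Suc i} \<in> E - {{u, w}}" if "Suc i < length ys" for i
    using successively_nth[OF R(1) that] R(2) by blast
  have "length ys \<noteq> 0" using ys by simp
  moreover have "length ys \<noteq> 1"
    using hd last e(2) by auto
  \<comment> \<open>A path with two vertices would traverse the edge \<open>{u, w}\<close>, which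
    \<open>R\<close> excludes.\<close>
  moreover have "length ys \<noteq> 2"
    using hd last step[of 0] by auto
  ultimately have len: "3 \<le> length ys" by linarith
  show inner: "{ys ! i, ys ! Suc i} \<in> circuit_edges ys" if "Suc i < length ys" for i
    unfolding circuit_edges_def using that by (intro CollectI exI[of _ i]) auto
  show "{u, w} \<in> circuit_edges ys"
  proof -
    have "Suc (length ys - 1) = length ys" using len by simp
    then show ?thesis
      unfolding circuit_edges_def using len hd last
      by (intro CollectI exI[of _ "length ys - 1"]) (auto simp: insert_commute simp del: One_nat_def)
  qed
  have "{ys ! i, ys ! (Suc i mod length ys)} \<in> E" if "i < length ys" for i
  proof (cases "Suc i < length ys")
    case True
    then show ?thesis using step by auto
  next
    case False
    then have "i = length ys - 1" "Suc i = length ys" using that by auto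
    then show ?thesis using hd last e(1) by (simp add: insert_commute)
  qed
  then show "is_circuit E ys"
    unfolding is_circuit_def circuit_edges_def using len ys(1) by auto
qed

text \<open>The edge \<open>e\<close> is inserted separately because it need not lie on any short
  circuit.\<close>

definition near_edges :: "'v set set \<Rightarrow> nat \<Rightarrow> 'v set \<Rightarrow> 'v set set" where
  "near_edges E n e = insert e
     (\<Union>xs\<in>{xs. is_circuit E xs \<and> length xs \<le> n \<and> e \<in> circuit_edges xs}. circuit_edges xs)"

lemma circuit_edges_image:
  "circuit_edges xs = (\<lambda>i. {xs ! i, xs ! (Suc i mod length xs)}) ` {..<length xs}"
  unfolding circuit_edges_def by auto

lemma finite_circuit_edges: "finite (circuit_edges xs)"
  by (simp add: circuit_edges_image)

lemma circuit_edges_map: "circuit_edges (map f xs) = (`) f ` circuit_edges xs"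
  unfolding circuit_edges_image image_image
proof (rule image_cong)
  fix i assume "i \<in> {..<length xs}"
  then have "i < length xs" "Suc i mod length xs < length xs"
    by (auto intro!: mod_less_divisor)
  then show "{map f xs ! i, map f xs ! (Suc i mod length (map f xs))}
      = f ` {xs ! i, xs ! (Suc i mod length xs)}"
    by simp
qed simp

lemma finite_near_edges:
  assumes "fine_graph E" "e \<in> E"
  shows "finite (near_edges E n e)"
proof -
  have "{xs. is_circuit E xs \<and> length xs \<le> n \<and> e \<in> circuit_edges xs}
      = (\<Union>k\<le>n. {xs. is_circuit E xs \<and> length xs = k \<and> e \<in> circuit_edges xs})"
    by auto
  moreover have "finite \<dots>"
    using assms unfolding fine_graph_def by auto
  ultimately show ?thesis
    unfolding near_edges_def by (simp add: finite_circuit_edges)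
qed

lemma near_edges_subset: "e \<in> E \<Longrightarrow> near_edges E n e \<subseteq> E"
  unfolding near_edges_def is_circuit_def by auto

text \<open>The loop-erased walk closes up with \<open>{u, w}\<close> to a circuit. It starts in
  \<open>X\<close> and ends in the disjoint set \<open>Y\<close>, so it has to use an edge of
  \<open>B\<close> on the way.\<close>

lemma crossing_edge_near:
  assumes e: "{u, w} \<in> E" "u \<in> X" "w \<in> Y" "X \<inter> Y = {}"
    and walk: "reach R k u w"
    and R: "\<And>p q. R p q \<Longrightarrow> {p, q} \<in> E \<and> ({p, q} \<subseteq> X \<or> {p, q} \<subseteq> Y \<or> {p, q} \<in> B)"
  shows "\<exists>f\<in>B. f \<in> near_edges E (Suc k) {u, w}"
proof (cases "{u, w} \<in> B")
  case True
  then show ?thesis unfolding near_edges_def by blast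
next
  case False
  have uw: "u \<noteq> w" using e by auto
  \<comment> \<open>The walk cannot use \<open>{u, w}\<close>, which lies neither inside
    \<open>X\<close> nor inside \<open>Y\<close> and in this case is not in
    \<open>B\<close>.\<close>
  have ne: "{p, q} \<noteq> {u, w}" if "R p q" for p q
    using R[OF that] e False by auto
  obtain l where l: "l \<le> k" "(R ^^ l) u w"
    using walk unfolding reach_def by blast
  obtain ys where ys: "ys \<noteq> []" "distinct ys" "hd ys = u" "last ys = w" "length ys \<le> Suc l"
      "successively R ys"
    using relpowp_imp_distinct_path[OF l(2)] by blast
  have R': "{p, q} \<in> E - {{u, w}}" if "R p q" for p q
    using R[OF that] ne[OF that] by blast
  note circ = path_closes_to_circuit[OF e(1) uw ys(2,1,3,4,6) R']
  have near: "{ys ! i, ys ! Suc i} \<in> near_edges E (Suc k) {u, w}" if "Suc i < length ys" for i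
    unfolding near_edges_def using circ(1,2) circ(3)[OF _ that] ys(5) l(1) by auto
  show ?thesis
  proof (rule ccontr)
    assume no: "\<not> ?thesis"
    have "ys ! i \<in> X" if "i < length ys" for i
      using that
    proof (induction i)
      case 0
      then show ?case using ys e(2) by (simp add: hd_conv_nth)
    next
      case (Suc i)
      then have "ys ! i \<in> X" by simp
      moreover have "{ys ! i, ys ! Suc i} \<notin> B"
        using no near[OF Suc.prems] by blast
      ultimately show ?case
        using R[OF successively_nth[OF ys(6) Suc.prems]] e(4) by auto
    qed
    then have "w \<in> X"
      using ys by (metis last_conv_nth diff_less length_greater_0_conv zero_less_one)
    then show False using e by auto
  qed
qed

section \<open>The graph metric\<close>

locale conn_graph =
  fixes V :: "'v set" and E :: "'v set set"
  assumes conn: "connected_graph V E"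
begin

abbreviation adj :: "'v \<Rightarrow> 'v \<Rightarrow> bool" where
  "adj x y \<equiv> {x, y} \<in> E"

abbreviation d :: "'v \<Rightarrow> 'v \<Rightarrow> nat" where
  "d \<equiv> graph_dist V E"

lemma edgeD: "adj x y \<Longrightarrow> x \<in> V \<and> y \<in> V \<and> x \<noteq> y"
  using conn unfolding connected_graph_def simplicial_graph_def
  by (cases "x = y") fastforce+

lemma adj_sym: "adj x y \<Longrightarrow> adj y x"
  by (simp add: insert_commute)

text \<open>\<open>Suc n\<close> vertices make \<open>n\<close> steps. Membership of
  \<open>u\<close> in \<open>V\<close> is stated separately because a walk without steps does not
  imply it.\<close>

lemma walk_iff_relpowp:
  "(\<exists>xs. walk_between V E u xs v \<and> length xs = Suc n) \<longleftrightarrow> u \<in> V \<and> (adj ^^ n) u v"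
proof (induction n arbitrary: u)
  case 0
  have "walk_between V E u xs v \<and> length xs = Suc 0 \<longleftrightarrow> xs = [u] \<and> u = v \<and> u \<in> V" for xs
    unfolding walk_between_def by (auto simp: length_Suc_conv)
  then show ?case by auto
next
  case (Suc n)
  have "(\<exists>xs. walk_between V E u xs v \<and> length xs = Suc (Suc n)) \<longleftrightarrow>
      (\<exists>z ys. adj u z \<and> walk_between V E z ys v \<and> length ys = Suc n)" (is "?L \<longleftrightarrow> ?R")
  proof
    assume ?L
    then obtain xs where xs: "walk_between V E u xs v" "length xs = Suc (Suc n)" by blast
    then obtain ys where ys: "xs = u # ys" "ys \<noteq> []" "length ys = Suc n"
      unfolding walk_between_def by (cases xs; cases "tl xs") auto
    then have "adj u (hd ys)" "walk_between V E (hd ys) ys v"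
      using xs unfolding walk_between_def by (auto simp: successively_Cons)
    then show ?R using ys(3) by blast
  next
    assume ?R
    then obtain z ys where ys: "adj u z" "walk_between V E z ys v" "length ys = Suc n" by blast
    then have "walk_between V E u (u # ys) v"
      using edgeD[OF ys(1)] unfolding walk_between_def by (auto simp: successively_Cons)
    then show ?L using ys(3) by (intro exI[of _ "u # ys"]) auto
  qed
  also have "\<dots> \<longleftrightarrow> (\<exists>z. adj u z \<and> z \<in> V \<and> (adj ^^ n) z v)"
    using Suc.IH by blast
  also have "\<dots> \<longleftrightarrow> u \<in> V \<and> (adj ^^ Suc n) u v"
    unfolding relpowp_Suc_left OO_def using edgeD by blast
  finally show ?case .
qed

lemma dist_le: "u \<in> V \<Longrightarrow> (adj ^^ k) u v \<Longrightarrow> d u v \<le> k"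
  unfolding graph_dist_def by (rule Least_le) (simp add: walk_iff_relpowp)

lemma dist_walk:
  assumes "u \<in> V" "v \<in> V"
  shows "(adj ^^ d u v) u v"
proof -
  obtain xs where xs: "walk_between V E u xs v"
    using conn assms unfolding connected_graph_def by blast
  then have "\<exists>n. \<exists>xs. walk_between V E u xs v \<and> length xs = Suc n"
    by (intro exI[of _ "length xs - 1"] exI[of _ xs]) (auto simp: walk_between_def)
  then have "\<exists>xs. walk_between V E u xs v \<and> length xs = Suc (d u v)"
    unfolding graph_dist_def by (rule LeastI_ex)
  then show ?thesis by (simp add: walk_iff_relpowp)
qed

lemma dist_sym:
  assumes "u \<in> V" "v \<in> V"
  shows "d u v = d v u"
proof (rule antisym)
  show "d u v \<le> d v u" "d v u \<le> d u v"
    by (rule dist_le, fact, rule relpowp_sym[OF adj_sym], assumption, rule dist_walk; fact)+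
qed

lemma dist_triangle:
  assumes "u \<in> V" "v \<in> V" "w \<in> V"
  shows "d u w \<le> d u v + d v w"
  by (rule dist_le[OF assms(1) relpowp_trans]) (rule dist_walk; fact)+

lemma dist_self [simp]: "u \<in> V \<Longrightarrow> d u u = 0"
  using dist_le[of u 0 u] by simp

lemma dist_eq_0: "u \<in> V \<Longrightarrow> v \<in> V \<Longrightarrow> d u v = 0 \<Longrightarrow> u = v"
  using dist_walk[of u v] by simp

lemma adj_dist_le: "adj u v \<Longrightarrow> d u v \<le> 1"
  by (rule dist_le) (use edgeD in \<open>auto simp only: relpowp_1\<close>)

lemma adj_dist: "adj u v \<Longrightarrow> d u v = 1"
  using adj_dist_le[of u v] edgeD[of u v] dist_eq_0[of u v] by linarith

lemma reach_in_ball: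
  assumes "u \<in> V" "v \<in> V" "d u v \<le> r"
  shows "reach (\<lambda>p q. adj p q \<and> {p, q} \<subseteq> {z. d u z \<le> r}) r u v"
proof -
  obtain f where f: "f 0 = u" "f (d u v) = v" "\<And>i. i < d u v \<Longrightarrow> adj (f i) (f (Suc i))"
    using dist_walk[OF assms(1,2)] by (auto simp: relpowp_fun_conv)
  have le: "d u (f i) \<le> i" if "i \<le> d u v" for i
    using relpowp_along[of i adj f 0] f that assms(1) by (auto intro: dist_le)
  have "((\<lambda>p q. adj p q \<and> {p, q} \<subseteq> {z. d u z \<le> r}) ^^ d u v) u v"
    unfolding relpowp_fun_conv
  proof (intro exI[of _ f] conjI allI impI)
    fix i assume i: "i < d u v"
    show "{f i, f (Suc i)} \<subseteq> {z. d u z \<le> r}"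
      using le[of i] le[of "Suc i"] i assms(3) by auto
  qed (use f in auto)
  then show ?thesis
    unfolding reach_def using assms(3) by blast
qed

lemma geodesic_exists:
  assumes "u \<in> V" "v \<in> V"
  obtains f where "f 0 = u" "f (d u v) = v" "\<And>i. i < d u v \<Longrightarrow> adj (f i) (f (Suc i))"
    "\<And>i. i \<le> d u v \<Longrightarrow> f i \<in> V"
    "\<And>i j. i \<le> j \<Longrightarrow> j \<le> d u v \<Longrightarrow> d (f i) (f j) = j - i"
proof -
  obtain f where f: "f 0 = u" "f (d u v) = v" "\<And>i. i < d u v \<Longrightarrow> adj (f i) (f (Suc i))"
    using dist_walk[OF assms] by (auto simp: relpowp_fun_conv)
  have V: "f i \<in> V" if "i \<le> d u v" for i
    using that f(2) f(3)[of i] edgeD[of "f i" "f (Suc i)"] assms(2) by (cases "i = d u v") auto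
  have le: "d (f i) (f j) \<le> j - i" if "i \<le> j" "j \<le> d u v" for i j
    using relpowp_along[of "j - i" adj f i] f(3) that V[of i] by (auto intro!: dist_le)
  have "d (f i) (f j) = j - i" if "i \<le> j" "j \<le> d u v" for i j
  proof -
    \<comment> \<open>A shortcut between \<open>f i\<close> and \<open>f j\<close> would shorten the
      walk from \<open>u\<close> to \<open>v\<close>.\<close>
    have "d u v \<le> d u (f i) + d (f i) (f j) + d (f j) v"
      using dist_triangle[of u "f i" v] dist_triangle[of "f i" "f j" v] V[of i] V[of j] assms that
      by linarith
    moreover have "d u (f i) \<le> i" "d (f j) v \<le> d u v - j"
      using le[of 0 i] le[of j "d u v"] that f(1,2) by auto
    ultimately show ?thesis using le[OF that] that by linarith
  qed
  then show thesis using that f V by blast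
qed

text \<open>\<open>w\<close> is the second vertex of a geodesic from \<open>v\<close> to
  \<open>u\<close>, which never returns to \<open>v\<close>.\<close>

lemma first_step:
  assumes "u \<in> V" "v \<in> V" "u \<noteq> v"
  obtains w where "adj v w" "d w u < d v u"
    "reach (\<lambda>p q. adj p q \<and> p \<noteq> v \<and> q \<noteq> v) (d v u) w u"
proof -
  obtain f where f: "f 0 = v" "f (d v u) = u" "\<And>i. i < d v u \<Longrightarrow> adj (f i) (f (Suc i))"
    "\<And>i. i \<le> d v u \<Longrightarrow> f i \<in> V" "\<And>i j. i \<le> j \<Longrightarrow> j \<le> d v u \<Longrightarrow> d (f i) (f j) = j - i"
    using geodesic_exists[OF assms(2,1)] by blast
  have pos: "0 < d v u"
    using assms dist_eq_0[of v u] by (cases "d v u") auto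
  have ne: "f i \<noteq> v" if "0 < i" "i \<le> d v u" for i
    using f(5)[of 0 i] that f(1) assms by auto
  have "((\<lambda>p q. adj p q \<and> p \<noteq> v \<and> q \<noteq> v) ^^ (d v u - 1)) (f 1) (f (1 + (d v u - 1)))"
    by (rule relpowp_along) (use f(3) ne in auto)
  then have "reach (\<lambda>p q. adj p q \<and> p \<noteq> v \<and> q \<noteq> v) (d v u) (f 1) u"
    unfolding reach_def using pos f(2) by (intro exI[of _ "d v u - 1"]) auto
  moreover have "adj v (f 1)"
    using f(3)[of 0] f(1) pos by simp
  moreover have "d (f 1) u < d v u"
    using f(5)[of 1 "d v u"] f(2) pos by simp
  ultimately show thesis using that by blast
qed

text \<open>Infinitely many such \<open>w\<close> would give infinitely many circuits of bounded length through
  \<open>v\<close> and one of them.\<close>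
lemma finite_star:
  assumes fine: "fine_graph E"
  shows "finite {w. adj v w \<and> reach (\<lambda>p q. adj p q \<and> p \<noteq> v \<and> q \<noteq> v) n w z}"
    (is "finite ?W")
proof (cases "?W = {}")
  case False
  let ?R = "\<lambda>p q. adj p q \<and> p \<noteq> v \<and> q \<noteq> v"
  obtain w1 where w1: "adj v w1" "reach ?R n w1 z" using False by blast
  have "?W \<subseteq> \<Union> (near_edges E (Suc (1 + (n + n))) {v, w1})"
  proof
    fix w assume "w \<in> ?W"
    then have w: "adj v w" "reach ?R n w z" by auto
    \<comment> \<open>At \<open>v\<close> this relation allows only the edge \<open>{v, w}\<close>,
      so with \<open>X = {v}\<close> it is the crossing edge, and hence near
      \<open>{v, w1}\<close>.\<close>
    let ?Q = "\<lambda>p q. adj p q \<and> ((p \<noteq> v \<and> q \<noteq> v) \<or> {p, q} = {v, w})"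
    have "reach ?R n z w1" by (rule reach_sym[OF w1(2)]) (auto simp: insert_commute)
    then have "reach ?R (n + n) w w1" using w(2) reach_trans by fast
    then have "reach ?Q (n + n) w w1" by (rule reach_mono) auto
    moreover have "reach ?Q 1 v w" by (rule reach_step) (use w in auto)
    ultimately have "reach ?Q (1 + (n + n)) v w1" using reach_trans by fast
    then have "\<exists>f\<in>{{v, w}}. f \<in> near_edges E (Suc (1 + (n + n))) {v, w1}"
    proof (rule crossing_edge_near[where X = "{v}" and Y = "- {v}", rotated 4])
      show "w1 \<in> - {v}" using edgeD[OF w1(1)] by auto
    qed (use w1 in auto)
    then show "w \<in> \<Union> (near_edges E (Suc (1 + (n + n))) {v, w1})" by auto
  qed
  moreover have "finite (\<Union> (near_edges E (Suc (1 + (n + n))) {v, w1}))"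
  proof (rule finite_Union)
    show "finite (near_edges E (Suc (1 + (n + n))) {v, w1})"
      by (rule finite_near_edges[OF fine w1(1)])
    show "finite M" if "M \<in> near_edges E (Suc (1 + (n + n))) {v, w1}" for M
    proof -
      have "M \<in> E" using that near_edges_subset[OF w1(1)] by blast
      then have "card M = 2"
        using conn unfolding connected_graph_def simplicial_graph_def by blast
      then show ?thesis by (metis card.infinite zero_neq_numeral)
    qed
  qed
  ultimately show ?thesis by (rule finite_subset)
next
  case True
  then show ?thesis by (simp only: finite.emptyI)
qed

end

section \<open>Actions on fine graphs\<close>

text \<open>Hyperbolicity stays outside the locale and enters through the constant of
  \<open>four_point\<close>.\<close>

locale fine_action = conn_graph V E + group G
  for V :: "'v set" and E :: "'v set set" and G :: "('a, 'b) monoid_scheme" (structure) +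
  fixes \<phi> :: "'a \<Rightarrow> 'v \<Rightarrow> 'v"
  assumes act: "acts_on_graph G V E \<phi>"
    and fine: "fine_graph E"
    and finite_orbits: "finite (orbits G E (edge_action \<phi>))"
    and finite_stabilizers: "\<And>e. e \<in> E \<Longrightarrow> finite (stabilizer G (edge_action \<phi>) e)"
begin

sublocale group_action G V \<phi>
  using act unfolding acts_on_graph_def by blast

lemma act_closed: "g \<in> carrier G \<Longrightarrow> v \<in> V \<Longrightarrow> \<phi> g v \<in> V"
  using element_image by blast

lemma act_one: "v \<in> V \<Longrightarrow> \<phi> \<one> v = v"
  using id_eq_one by (metis restrict_apply')

lemma act_inv:
  assumes "g \<in> carrier G" "v \<in> V"
  shows "\<phi> (inv g) (\<phi> g v) = v" "\<phi> g (\<phi> (inv g) v) = v"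
  using assms composition_rule[of v "inv g" g] composition_rule[of v g "inv g"]
  by (auto simp: act_one)

lemma act_eq_iff: "g \<in> carrier G \<Longrightarrow> u \<in> V \<Longrightarrow> v \<in> V \<Longrightarrow> \<phi> g u = \<phi> g v \<longleftrightarrow> u = v"
  using act_inv(1) by metis

lemma act_edge: "g \<in> carrier G \<Longrightarrow> e \<in> E \<Longrightarrow> \<phi> g ` e \<in> E"
  using act unfolding acts_on_graph_def by blast

lemma act_adj:
  assumes "g \<in> carrier G" "adj x y"
  shows "adj (\<phi> g x) (\<phi> g y)"
  using act_edge[OF assms] by simp

lemma act_dist:
  assumes "g \<in> carrier G" "x \<in> V" "y \<in> V"
  shows "d (\<phi> g x) (\<phi> g y) = d x y"
proof -
  have le: "d (\<phi> h u) (\<phi> h v) \<le> d u v" if "h \<in> carrier G" "u \<in> V" "v \<in> V" for h u v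
  proof (rule dist_le)
    show "(adj ^^ d u v) (\<phi> h u) (\<phi> h v)"
      using relpowp_map[of adj adj "\<phi> h", OF _ dist_walk[OF that(2,3)]] act_adj[OF that(1)] by blast
  qed (use that act_closed in auto)
  have "d x y \<le> d (\<phi> g x) (\<phi> g y)"
    using le[of "inv g" "\<phi> g x" "\<phi> g y"] assms by (simp add: act_inv act_closed)
  then show ?thesis using le[OF assms] by simp
qed

lemma edge_subset: "e \<in> E \<Longrightarrow> e \<subseteq> V"
  using conn unfolding connected_graph_def simplicial_graph_def by blast

lemma edge_action_mult:
  assumes "g \<in> carrier G" "h \<in> carrier G" "e \<in> E"
  shows "\<phi> (g \<otimes> h) ` e = \<phi> g ` \<phi> h ` e"
  using assms edge_subset[OF assms(3)] composition_rule[of _ g h]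
  by (auto simp: image_image intro!: image_cong)

lemma edge_action_inv:
  assumes "g \<in> carrier G" "e \<in> E"
  shows "\<phi> (inv g) ` \<phi> g ` e = e"
  using assms edge_subset[OF assms(2)] act_inv(1)[OF assms(1)]
  by (force simp: image_image)

text \<open>The value at an edge is at most that at a chosen representative of its orbit, and there
  are finitely many orbits.\<close>

lemma bounded_on_edges:
  fixes f :: "'v set \<Rightarrow> nat"
  assumes "\<And>g e. g \<in> carrier G \<Longrightarrow> e \<in> E \<Longrightarrow> f e \<le> f (\<phi> g ` e)"
  shows "\<exists>N. \<forall>e\<in>E. f e \<le> N"
proof -
  let ?rep = "\<lambda>X. f (SOME e. e \<in> X)"
  have "f e \<le> Max (?rep ` orbits G E (edge_action \<phi>))" if e: "e \<in> E" for e
  proof -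
    let ?X = "orbit G (edge_action \<phi>) e"
    have "?X \<noteq> {}" unfolding orbit_def by blast
    then have "(SOME e'. e' \<in> ?X) \<in> ?X" by (simp add: some_in_eq)
    then obtain g where "g \<in> carrier G" "(SOME e'. e' \<in> ?X) = \<phi> g ` e"
      unfolding orbit_def by auto
    then have "f e \<le> ?rep ?X" using assms e by simp
    also have "\<dots> \<le> Max (?rep ` orbits G E (edge_action \<phi>))"
      using finite_orbits e unfolding orbits_def by (intro Max_ge) auto
    finally show ?thesis .
  qed
  then show ?thesis by blast
qed

lemma is_circuit_map:
  assumes "is_circuit E xs" "g \<in> carrier G"
  shows "is_circuit E (map (\<phi> g) xs)"
proof -
  have "set xs \<subseteq> V"
  proof
    fix x assume "x \<in> set xs"
    then obtain i where "i < length xs" "x = xs ! i" by (auto simp: in_set_conv_nth)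
    then have "\<exists>e\<in>circuit_edges xs. x \<in> e" unfolding circuit_edges_def by blast
    then show "x \<in> V" using assms(1) edge_subset unfolding is_circuit_def by blast
  qed
  then have "inj_on (\<phi> g) (set xs)"
    using inj_prop[OF assms(2)] inj_on_subset by blast
  then show ?thesis
    using assms act_edge unfolding is_circuit_def by (auto simp: distinct_map circuit_edges_map)
qed

lemma bounded_near_edges: "\<exists>N. \<forall>e\<in>E. card (near_edges E n e) \<le> N"
proof (rule bounded_on_edges)
  fix g e assume g: "g \<in> carrier G" and e: "e \<in> E"
  have "(`) (\<phi> g) ` near_edges E n e \<subseteq> near_edges E n (\<phi> g ` e)"
  proof
    fix f assume "f \<in> (`) (\<phi> g) ` near_edges E n e"
    then consider "f = \<phi> g ` e" | xs where "is_circuit E xs" "length xs \<le> n" "e \<in> circuit_edges xs"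
        "f \<in> (`) (\<phi> g) ` circuit_edges xs"
      unfolding near_edges_def by auto
    then show "f \<in> near_edges E n (\<phi> g ` e)"
    proof cases
      case 2
      then show ?thesis
        unfolding near_edges_def using is_circuit_map[OF 2(1) g]
        by (intro insertI2 UN_I[of "map (\<phi> g) xs"]) (auto simp: circuit_edges_map)
    qed (simp add: near_edges_def)
  qed
  moreover have "inj_on ((`) (\<phi> g)) (near_edges E n e)"
    using near_edges_subset[OF e] edge_action_inv[OF g] by (metis inj_onI subsetD)
  ultimately show "card (near_edges E n e) \<le> card (near_edges E n (\<phi> g ` e))"
    by (intro card_inj_on_le[of "(`) (\<phi> g)"] finite_near_edges[OF fine] act_edge[OF g e])
qed

abbreviation transporter :: "'v set \<Rightarrow> 'v set \<Rightarrow> 'a set" where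
  "transporter e f \<equiv> {h \<in> carrier G. \<phi> h ` e = f}"

text \<open>The elements carrying \<open>e\<close> to \<open>f\<close> form a coset of the
  stabiliser of \<open>e\<close>.\<close>

lemma transporter_inj:
  assumes "e \<in> E" "h0 \<in> transporter e f"
  shows "(\<lambda>h. inv h0 \<otimes> h) ` transporter e f \<subseteq> stabilizer G (edge_action \<phi>) e"
    "inj_on (\<lambda>h. inv h0 \<otimes> h) (transporter e f)"
proof -
  show "(\<lambda>h. inv h0 \<otimes> h) ` transporter e f \<subseteq> stabilizer G (edge_action \<phi>) e"
  proof
    fix k assume "k \<in> (\<lambda>h. inv h0 \<otimes> h) ` transporter e f"
    then obtain h where h: "h \<in> transporter e f" "k = inv h0 \<otimes> h" by blast
    then have "\<phi> k ` e = \<phi> (inv h0) ` \<phi> h0 ` e"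
      using assms edge_action_mult[of "inv h0" h e] by simp
    then show "k \<in> stabilizer G (edge_action \<phi>) e"
      unfolding stabilizer_def using h assms edge_action_inv[of h0 e] by simp
  qed
  show "inj_on (\<lambda>h. inv h0 \<otimes> h) (transporter e f)"
    using assms(2) by (auto intro!: inj_onI)
qed

lemma finite_transporter:
  assumes e: "e \<in> E"
  shows "finite (transporter e f)"
proof (cases "transporter e f = {}")
  case False
  then obtain h0 where "h0 \<in> transporter e f" by blast
  note inj = transporter_inj[OF e this]
  show ?thesis
    by (rule inj_on_finite[OF inj(2,1) finite_stabilizers[OF e]])
qed (simp only: finite.emptyI)

text \<open>Conjugation by \<open>g\<close> embeds the stabiliser of \<open>e\<close> into that of
  its translate. So edge stabilisers have bounded size, and transporters are no larger.\<close>

lemma bounded_transporters: "\<exists>N. \<forall>e\<in>E. \<forall>f. card (transporter e f) \<le> N"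
proof -
  let ?s = "\<lambda>e. stabilizer G (edge_action \<phi>) e"
  have "\<exists>N. \<forall>e\<in>E. card (?s e) \<le> N"
  proof (rule bounded_on_edges)
    fix g e assume g: "g \<in> carrier G" and e: "e \<in> E"
    have "(\<lambda>h. g \<otimes> h \<otimes> inv g) ` ?s e \<subseteq> ?s (\<phi> g ` e)"
    proof
      fix k assume "k \<in> (\<lambda>h. g \<otimes> h \<otimes> inv g) ` ?s e"
      then obtain h where h: "h \<in> carrier G" "\<phi> h ` e = e" "k = g \<otimes> h \<otimes> inv g"
        unfolding stabilizer_def by auto
      have "\<phi> k ` \<phi> g ` e = \<phi> (k \<otimes> g) ` e"
        using h g e by (simp only: edge_action_mult inv_closed m_closed)
      also have "k \<otimes> g = g \<otimes> h" using h g by (simp add: m_assoc)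
      also have "\<phi> (g \<otimes> h) ` e = \<phi> g ` e"
        using h g e by (simp only: edge_action_mult)
      finally show "k \<in> ?s (\<phi> g ` e)" unfolding stabilizer_def using h g by simp
    qed
    moreover have "inj_on (\<lambda>h. g \<otimes> h \<otimes> inv g) (?s e)"
      unfolding stabilizer_def using g by (auto intro!: inj_onI)
    ultimately show "card (?s e) \<le> card (?s (\<phi> g ` e))"
      using finite_stabilizers act_edge[OF g e] by (intro card_inj_on_le)
  qed
  then obtain N where N: "\<And>e. e \<in> E \<Longrightarrow> card (?s e) \<le> N" by blast
  have "card (transporter e f) \<le> N" if e: "e \<in> E" for e f
  proof (cases "transporter e f = {}")
    case False
    then obtain h0 where "h0 \<in> transporter e f" by blast
    note inj = transporter_inj[OF e this]
    have "card (transporter e f) \<le> card (?s e)"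
      by (rule card_inj_on_le[OF inj(2,1) finite_stabilizers[OF e]])
    then show ?thesis using N[OF e] by simp
  qed (simp only: card.empty)
  then show ?thesis by blast
qed

subsection \<open>Fixed vertices\<close>

text \<open>If the orbit were finite, infinitely many distinct powers of \<open>c\<close> would lie
  in one transporter, which is finite.\<close>

lemma infinite_edge_orbit:
  assumes c: "c \<in> carrier G" "ord c = 0" and e: "e \<in> E"
  shows "infinite (range (\<lambda>n::nat. \<phi> (c [^] n) ` e))"
proof
  assume "finite (range (\<lambda>n::nat. \<phi> (c [^] n) ` e))"
  then obtain m :: nat where "infinite {n::nat. \<phi> (c [^] n) ` e = \<phi> (c [^] m) ` e}"
    using pigeonhole_infinite[of UNIV "\<lambda>n::nat. \<phi> (c [^] n) ` e"] by auto
  moreover have "inj (\<lambda>n::nat. c [^] n)"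
  proof (rule injI)
    fix k l :: nat assume "c [^] k = c [^] l"
    then have "c [^] (int k - int l) = \<one>"
      using c by (simp add: int_pow_diff int_pow_int)
    moreover have "c [^] (int l - int k) = \<one>"
      using \<open>c [^] k = c [^] l\<close> c by (simp add: int_pow_diff int_pow_int)
    ultimately have "c [^] (nat \<bar>int k - int l\<bar>) = \<one>"
      by (cases "l \<le> k") (auto simp flip: int_pow_int)
    then have "nat \<bar>int k - int l\<bar> = 0" using c ord_eq_0 by blast
    then show "k = l" by linarith
  qed
  ultimately have "infinite ((\<lambda>n::nat. c [^] n) ` {n. \<phi> (c [^] n) ` e = \<phi> (c [^] m) ` e})"
    using finite_imageD inj_on_subset by blast
  moreover have "(\<lambda>n::nat. c [^] n) ` {n. \<phi> (c [^] n) ` e = \<phi> (c [^] m) ` e}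
      \<subseteq> transporter e (\<phi> (c [^] m) ` e)"
    using c by auto
  ultimately show False using finite_transporter[OF e] finite_subset by blast
qed

lemma act_pow_fix:
  assumes "c \<in> carrier G" "v \<in> V" "\<phi> c v = v"
  shows "\<phi> (c [^] (n::nat)) v = v"
  using assms by (induction n) (auto simp: act_one composition_rule)

text \<open>Powers of \<open>c\<close> carry the first edge of a geodesic from \<open>v\<close> to
  \<open>u\<close> to infinitely many edges at \<open>v\<close>. Their other ends all reach
  \<open>u\<close> in boundedly many steps off \<open>v\<close>, contrary to
  \<open>finite_star\<close>.\<close>

lemma fixed_vertex_unique:
  assumes c: "c \<in> carrier G" "ord c = 0"
    and uv: "u \<in> V" "v \<in> V" "\<phi> c u = u" "\<phi> c v = v"
  shows "u = v"
proof (rule ccontr)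
  assume "u \<noteq> v"
  let ?R = "\<lambda>p q. adj p q \<and> p \<noteq> v \<and> q \<noteq> v"
  obtain w where w: "adj v w" "reach ?R (d v u) w u"
    using first_step[OF uv(1,2) \<open>u \<noteq> v\<close>] by blast
  let ?W = "{w. adj v w \<and> reach ?R (d v u) w u}"
  have "\<phi> (c [^] n) ` {v, w} \<in> (\<lambda>w. {v, w}) ` ?W" for n :: nat
  proof -
    let ?g = "c [^] n"
    have g: "?g \<in> carrier G" "\<phi> ?g v = v" "\<phi> ?g u = u"
      using c uv by (auto simp: act_pow_fix)
    have "reach ?R (d v u) (\<phi> ?g w) (\<phi> ?g u)"
    proof (rule reach_map[OF w(2)])
      fix p q assume pq: "?R p q"
      then show "?R (\<phi> ?g p) (\<phi> ?g q)"
        using act_adj[OF g(1), of p q] act_eq_iff[OF g(1), of _ v] edgeD[of p q] uv(2) g(2) by metis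
    qed
    then have "\<phi> ?g w \<in> ?W"
      using act_adj[OF g(1) w(1)] g(2,3) by simp
    then show ?thesis using g(2) by auto
  qed
  then have "range (\<lambda>n::nat. \<phi> (c [^] n) ` {v, w}) \<subseteq> (\<lambda>w. {v, w}) ` ?W" by blast
  then show False
    using infinite_edge_orbit[OF c w(1)] finite_star[OF fine, of v "d v u" u]
    by (meson finite_imageI finite_subset)
qed

text \<open>\<open>g\<close> maps fixed vertices of \<open>c\<close> to fixed vertices of
  \<open>c\<close>, and there is only one.\<close>

lemma commuting_fixed:
  assumes c: "c \<in> carrier G" "ord c = 0" "v \<in> V" "\<phi> c v = v"
    and g: "g \<in> carrier G" "c \<otimes> g = g \<otimes> c"
  shows "\<phi> g v = v"
proof -
  have "\<phi> c (\<phi> g v) = \<phi> g v"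
    using composition_rule[of v c g] composition_rule[of v g c] c g by simp
  then show ?thesis
    using fixed_vertex_unique[OF c(1,2), of "\<phi> g v" v] act_closed c g by auto
qed

text \<open>Choose \<open>v\<close> with infinitely many orbit points \<open>h x\<close> within a minimal radius. By minimality
  the geodesics from \<open>v\<close> to these points begin with infinitely many different edges. If \<open>g\<close>
  moved \<open>v\<close>, then these geodesics, their images under \<open>g\<close>, and the translates by \<open>h\<close> of
  a path from \<open>x\<close> to \<open>g x\<close> would give infinitely many bounded detours around \<open>v\<close>.\<close>
lemma bounded_orbit_fixes:
  assumes H: "H \<subseteq> carrier G" and x: "x \<in> V"
    and bounded: "infinite {h \<in> H. d x (\<phi> h x) \<le> R}"
    and free: "\<And>p q. p \<in> V \<Longrightarrow> q \<in> V \<Longrightarrow> finite {h \<in> H. \<phi> h p = q}"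
  obtains v where "v \<in> V"
    "\<And>g. g \<in> carrier G \<Longrightarrow> (\<And>h. h \<in> H \<Longrightarrow> g \<otimes> h = h \<otimes> g) \<Longrightarrow> \<phi> g v = v"
proof -
  let ?P = "\<lambda>r. \<exists>v\<in>V. infinite {h \<in> H. d v (\<phi> h x) \<le> r}"
  define r where "r = (LEAST r. ?P r)"
  have "?P R" using bounded x by blast
  then have "?P r" unfolding r_def by (rule LeastI)
  then obtain v where v: "v \<in> V" "infinite {h \<in> H. d v (\<phi> h x) \<le> r}" by blast
  have minimal: "finite {h \<in> H. d w (\<phi> h x) < r}" if "w \<in> V" for w
  proof (cases r)
    case (Suc r')
    then have "\<not> ?P r'" using not_less_Least[of r' ?P] r_def by simp
    then show ?thesis using that Suc by (simp add: less_Suc_eq_le)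
  qed simp
  have "\<phi> g v = v" if g: "g \<in> carrier G" and comm: "\<And>h. h \<in> H \<Longrightarrow> g \<otimes> h = h \<otimes> g" for g
  proof (rule ccontr)
    assume gv: "\<phi> g v \<noteq> v"
    let ?A = "\<lambda>p q. adj p q \<and> p \<noteq> v \<and> q \<noteq> v"
    \<comment> \<open>As \<open>g\<close> maps \<open>t\<close> to \<open>v\<close>, the image under
      \<open>g\<close> of a walk avoiding \<open>t\<close> avoids \<open>v\<close>.\<close>
    define t where "t = \<phi> (inv g) v"
    have t: "t \<in> V" "\<phi> g t = v" unfolding t_def using g v by (auto simp: act_closed act_inv)
    define n where "n = d x (\<phi> g x)"
    obtain f where f: "f 0 = x" "f n = \<phi> g x" "\<And>i. i < n \<Longrightarrow> adj (f i) (f (Suc i))"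
        "\<And>i. i \<le> n \<Longrightarrow> f i \<in> V"
      unfolding n_def using geodesic_exists[OF x act_closed[OF g x]] by metis
    \<comment> \<open>The detour runs from \<open>w\<close> to \<open>h x\<close>, on to
      \<open>g (h x)\<close>, back to \<open>g w\<close> and by one edge to
      \<open>g v\<close>.\<close>
    define N where "N = r + n + r + 1"
    let ?W = "\<lambda>z. {w. adj v w \<and> reach ?A N w z}"
    \<comment> \<open>For \<open>h\<close> outside this finite set, the translate by
      \<open>h\<close> of the path from \<open>x\<close> to \<open>g x\<close> avoids
      \<open>v\<close>.\<close>
    let ?bad = "\<Union>i\<in>{..n}. {h \<in> H. \<phi> h (f i) = v}"
    have "finite ?bad" using free f(4) v(1) by auto
    have "{h \<in> H. d v (\<phi> h x) \<le> r} \<subseteq> ?bad \<union> (\<Union>w\<in>?W t \<union> ?W (\<phi> g v). {h \<in> H. d w (\<phi> h x) < r})"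
    proof
      fix h assume "h \<in> {h \<in> H. d v (\<phi> h x) \<le> r}"
      then have h: "h \<in> H" "d v (\<phi> h x) \<le> r" "h \<in> carrier G" using H by auto
      show "h \<in> ?bad \<union> (\<Union>w\<in>?W t \<union> ?W (\<phi> g v). {h \<in> H. d w (\<phi> h x) < r})"
      proof (cases "h \<in> ?bad")
        case False
        then have avoid: "\<phi> h (f i) \<noteq> v" if "i \<le> n" for i using h(1) that by auto
        have hx: "\<phi> h x \<in> V" "\<phi> h x \<noteq> v" using avoid[of 0] f(1) act_closed h x by auto
        obtain w where w: "adj v w" "d w (\<phi> h x) < d v (\<phi> h x)"
            "reach ?A (d v (\<phi> h x)) w (\<phi> h x)"
          using first_step[OF hx(1) v(1) hx(2)] by blast
        have wV: "w \<in> V" using edgeD[OF w(1)] by simp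
        have to_h: "reach ?A r w (\<phi> h x)"
          by (rule reach_mono[OF w(3)]) (use h in auto)
        \<comment> \<open>If \<open>w\<close> does not reach \<open>t\<close> within
          \<open>r\<close> steps off \<open>v\<close>, its walk to \<open>h x\<close> avoids
          \<open>t\<close>, so the image of that walk under \<open>g\<close> avoids \<open>v\<close>
          and completes the detour to \<open>g v\<close>.\<close>
        have "w \<in> ?W t \<union> ?W (\<phi> g v)"
        proof (cases "reach ?A r w t")
          case True
          then have "reach ?A N w t" by (rule reach_mono) (auto simp: N_def)
          then show ?thesis using w(1) by simp
        next
          case no_t: False
          then have "w \<noteq> t" using reach_refl by metis
          let ?At = "\<lambda>p q. ?A p q \<and> p \<noteq> t \<and> q \<noteq> t"
          obtain k where k: "k \<le> r" "(?A ^^ k) w (\<phi> h x)" using to_h unfolding reach_def by blast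
          have "reach ?At r w (\<phi> h x)"
            using relpowp_avoids_or_meets[OF k(2) \<open>w \<noteq> t\<close>] no_t k(1)
            unfolding reach_def by (meson order_trans)
          then have "reach ?A r (\<phi> g w) (\<phi> g (\<phi> h x))"
          proof (rule reach_map)
            fix p q assume "?At p q"
            then show "?A (\<phi> g p) (\<phi> g q)"
              using act_adj[OF g, of p q] act_eq_iff[OF g _ t(1)] edgeD[of p q] t(2) by metis
          qed
          then have return: "reach ?A r (\<phi> g (\<phi> h x)) (\<phi> g w)"
            by (rule reach_sym) (auto simp: insert_commute)
          have "(?A ^^ n) (\<phi> h (f 0)) (\<phi> h (f (0 + n)))"
            by (rule relpowp_along[where f = "\<lambda>i. \<phi> h (f i)"])
              (use avoid f(3) act_adj[OF h(3)] in auto)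
          moreover have "\<phi> h (\<phi> g x) = \<phi> g (\<phi> h x)"
            using composition_rule[OF x] g h(3) comm[OF h(1)] by metis
          ultimately have mid: "reach ?A n (\<phi> h x) (\<phi> g (\<phi> h x))"
            unfolding reach_def using f(1,2) by auto
          have "\<phi> g w \<noteq> v"
            using act_eq_iff[OF g wV t(1)] t(2) \<open>w \<noteq> t\<close> by simp
          then have "reach ?A 1 (\<phi> g w) (\<phi> g v)"
            using act_adj[OF g w(1)] gv by (intro reach_step) (auto simp: insert_commute)
          then have "reach ?A N w (\<phi> g v)"
            unfolding N_def using to_h mid return by (blast intro: reach_trans)
          then show ?thesis using w(1) by simp
        qed
        moreover have "d w (\<phi> h x) < r" using w(2) h(2) by simp
        ultimately show ?thesis using h(1) by blast
      qed simp
    qed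
    moreover have "finite (?bad \<union> (\<Union>w\<in>?W t \<union> ?W (\<phi> g v). {h \<in> H. d w (\<phi> h x) < r}))"
    proof -
      have "finite (?W z)" for z by (rule finite_star[OF fine])
      moreover have "finite {h \<in> H. d w (\<phi> h x) < r}" if "w \<in> ?W t \<union> ?W (\<phi> g v)" for w
        using that edgeD by (intro minimal) auto
      ultimately show ?thesis using \<open>finite ?bad\<close> by blast
    qed
    ultimately show False using v(2) finite_subset by blast
  qed
  then show thesis using that v(1) by blast
qed

end

section \<open>Hyperbolicity\<close>

context conn_graph
begin

text \<open>Gromov's condition on vertices alone and with an integer constant, so that estimates
  become linear arithmetic over the naturals.\<close>

definition four_point :: "nat \<Rightarrow> bool" where
  "four_point k \<longleftrightarrow> (\<forall>x\<in>V. \<forall>y\<in>V. \<forall>z\<in>V. \<forall>w\<in>V.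
     d x z + d y w \<le> max (d x y + d z w) (d y z + d x w) + k)"

text \<open>A vertex is the point with all weight on it. For adjacent vertices the common-cell
  formula gives 1; without a common cell the minimum has the single entry
  \<open>d u v\<close>.\<close>

lemma realisation_dist_vertices:
  assumes "u \<in> V" "v \<in> V"
  shows "realisation_dist V E (\<lambda>x. of_bool (x = u)) (\<lambda>x. of_bool (x = v)) = real (d u v)"
proof -
  have supp: "supp (\<lambda>y. of_bool (y = x) :: real) = {x}" for x
    unfolding supp_def by auto
  consider "u = v" | "adj u v" "u \<noteq> v" | "\<not> (\<exists>c\<in>cells V E. {u, v} \<subseteq> c)"
  proof -
    have "u = v \<or> adj u v" if c: "c \<in> cells V E" "{u, v} \<subseteq> c" for c
    proof (cases "c \<in> E")
      case True
      then have "finite c" "card c = 2"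
        using conn unfolding connected_graph_def simplicial_graph_def
        by (metis card.infinite zero_neq_numeral)+
      then have "u = v \<or> {u, v} = c"
        using c(2) by (metis card_2_iff card_subset_eq)
      then show ?thesis using True by auto
    next
      case False
      then show ?thesis using c unfolding cells_def by auto
    qed
    then show thesis using that by blast
  qed
  then show ?thesis
  proof cases
    case 1
    then show ?thesis using assms unfolding realisation_dist_def supp by (auto simp: cells_def)
  next
    case 2
    then have "\<exists>c\<in>cells V E. {u} \<union> {v} \<subseteq> c" unfolding cells_def by auto
    then show ?thesis
      using 2 adj_dist[OF 2(1)] unfolding realisation_dist_def supp by simp
  next
    case 3
    then have "\<not> (\<exists>c\<in>cells V E. {u} \<union> {v} \<subseteq> c)" by auto
    then have "realisation_dist V E (\<lambda>x. of_bool (x = u)) (\<lambda>x. of_bool (x = v))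
        = Min {0 + real (d a b) + 0 | a b. a \<in> {u} \<and> b \<in> {v}}"
      unfolding realisation_dist_def supp by (subst if_not_P) (simp_all cong: conj_cong)
    then show ?thesis by simp
  qed
qed

lemma hyperbolic_imp_four_point:
  assumes "hyperbolic_graph V E"
  obtains k where "four_point k"
proof -
  obtain \<delta> where \<delta>: "\<And>x y z w. \<lbrakk>x \<in> realisation V E; y \<in> realisation V E; z \<in> realisation V E;
      w \<in> realisation V E\<rbrakk> \<Longrightarrow>
      min (gromov_product (realisation_dist V E) x y w) (gromov_product (realisation_dist V E) y z w)
        - \<delta> \<le> gromov_product (realisation_dist V E) x z w"
    using assms unfolding hyperbolic_graph_def gromov_hyperbolic_def by blast
  have real: "(\<lambda>y. of_bool (y = v)) \<in> realisation V E" if "v \<in> V" for v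
  proof -
    have "supp (\<lambda>y. of_bool (y = v) :: real) = {v}"
      unfolding supp_def by auto
    then show ?thesis
      using that unfolding realisation_def cells_def by auto
  qed
  have "d x z + d y w \<le> max (d x y + d z w) (d y z + d x w) + nat \<lceil>2 * \<delta>\<rceil>"
    if "x \<in> V" "y \<in> V" "z \<in> V" "w \<in> V" for x y z w
  proof -
    have "min ((real (d x w) + d y w - d x y) / 2) ((real (d y w) + d z w - d y z) / 2) - \<delta>
        \<le> (real (d x w) + d z w - d x z) / 2"
      using \<delta>[OF real real real real, OF that] that
      by (simp add: gromov_product_def realisation_dist_vertices)
    then have "real (d x z + d y w) \<le> max (d x y + d z w) (d y z + d x w) + 2 * \<delta>"
      by (auto simp: min_def max_def field_simps split: if_splits)
    also have "\<dots> \<le> real (max (d x y + d z w) (d y z + d x w) + nat \<lceil>2 * \<delta>\<rceil>)"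
      by linarith
    finally show ?thesis by linarith
  qed
  then show thesis using that unfolding four_point_def by blast
qed

text \<open>Replacing \<open>p'\<close> by \<open>p\<close> and then \<open>q'\<close> by
  \<open>q\<close> shows that \<open>z\<close> lies between \<open>p\<close> and \<open>q\<close> up
  to an error \<open>2 * k\<close>; \<open>far\<close> excludes the other alternative of each
  maximum. Comparing with \<open>y\<close>, at the same distance from \<open>p\<close>, costs one
  more \<open>k\<close>.\<close>

lemma fellow_travel:
  assumes hyp: "four_point k"
    and V: "p \<in> V" "q \<in> V" "p' \<in> V" "q' \<in> V" "y \<in> V" "z \<in> V"
    and C: "d p p' \<le> C" "d q q' \<le> C"
    and geod: "d p y + d y q = d p q" "d p' z + d z q' = d p' q'"
    and eq: "d p z = d p y"
    and far: "C + 2 * k < d p y" "C + 2 * k < d y q"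
  shows "d y z \<le> 3 * k"
proof -
  have hyp: "d x z + d y w \<le> max (d x y + d z w) (d y z + d x w) + k"
    if "x \<in> V" "y \<in> V" "z \<in> V" "w \<in> V" for x y z w
    using hyp that unfolding four_point_def by blast
  have sym: "d z p = d p z" "d q' p = d p q'" "d p' p = d p p'" "d q' q = d q q'" "d q z = d z q"
    using V by (auto intro: dist_sym)
  have tri: "d p q \<le> d p z + d z q"
    by (rule dist_triangle) fact+
  have 1: "d p' q' + d z p \<le> max (d p' z + d q' p) (d z q' + d p' p) + k"
    by (rule hyp) fact+
  have 2: "d z q' + d p z \<le> d p q' + k"
    using 1 C(1) geod(2) eq far(1) unfolding sym by linarith
  have 3: "d p q' + d z q \<le> max (d p z + d q' q) (d z q' + d p q) + k"
    by (rule hyp) fact+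
  have 4: "d p z + d z q \<le> d p q + 2 * k"
    using 2 3 C geod(1) eq far tri unfolding sym by linarith
  have 5: "d p q + d y z \<le> max (d p y + d q z) (d y q + d p z) + k"
    by (rule hyp) fact+
  show ?thesis
    using 4 5 geod(1) eq unfolding sym by linarith
qed

end

section \<open>Counting commuting elements by displacement\<close>

context fine_action
begin

text \<open>Elements \<open>h\<close> moving \<open>x\<close> by at most \<open>C\<close> move a long geodesic from \<open>x\<close> to \<open>g x\<close>
  to a geodesic that runs close to it. So \<open>h\<close> maps one of its first \<open>O(C)\<close> edges into the
  finite set of edges that share a short circuit with a given edge of the geodesic.\<close>
lemma linear_growth:
  assumes hyp: "four_point k"
    and A: "A \<subseteq> carrier G" "\<And>g h. g \<in> A \<Longrightarrow> h \<in> A \<Longrightarrow> g \<otimes> h = h \<otimes> g"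
    and x: "x \<in> V"
    and unbounded: "\<And>R. \<exists>g\<in>A. R < d x (\<phi> g x)"
  obtains K where "\<And>C. finite {h \<in> A. d x (\<phi> h x) \<le> C}"
    "\<And>C. card {h \<in> A. d x (\<phi> h x) \<le> C} \<le> K * Suc C"
proof -
  \<comment> \<open>\<open>L\<close> is the fellow-travelling distance.
    \<open>T = L + (2 * L + 1) + L\<close> bounds the distance between points within
    \<open>L\<close> of \<open>f i0\<close> and \<open>f i1\<close>. \<open>N\<close> is one more
    than the length of the walk from \<open>u\<close> to \<open>w\<close> built below.\<close>
  define L where "L = 3 * k"
  define T where "T = 4 * L + 1"
  define N where "N = Suc (L + (L + (T + (L + L))))"
  obtain Nn where Nn: "\<And>e. e \<in> E \<Longrightarrow> card (near_edges E N e) \<le> Nn"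
    using bounded_near_edges by blast
  obtain Ns where Ns: "\<And>e f. e \<in> E \<Longrightarrow> card (transporter e f) \<le> Ns"
    using bounded_transporters by blast
  define K where "K = (2 * k + 2 * L + 2) * (Nn * Ns)"
  have "finite {h \<in> A. d x (\<phi> h x) \<le> C} \<and> card {h \<in> A. d x (\<phi> h x) \<le> C} \<le> K * Suc C" for C
  proof -
    let ?S = "{h \<in> A. d x (\<phi> h x) \<le> C}"
    \<comment> \<open>Both indices are far enough from the ends for \<open>fellow_travel\<close>,
      and their difference \<open>2 * L + 1\<close> makes the balls of radius \<open>L\<close>
      disjoint. \<open>M\<close>, linear in \<open>C\<close>, bounds the indices involved.\<close>
    define i0 where "i0 = C + 2 * k + 1"
    define i1 where "i1 = i0 + 2 * L + 1"
    define M where "M = i1 + C"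
    obtain g where g: "g \<in> A" "M + 2 * k + 1 < d x (\<phi> g x)"
      using unbounded by blast
    define n where "n = d x (\<phi> g x)"
    have gG: "g \<in> carrier G" and gx: "\<phi> g x \<in> V" using g A act_closed x by auto
    obtain f where f: "f 0 = x" "f n = \<phi> g x" "\<And>i. i < n \<Longrightarrow> adj (f i) (f (Suc i))"
        "\<And>i. i \<le> n \<Longrightarrow> f i \<in> V" "\<And>i j. i \<le> j \<Longrightarrow> j \<le> n \<Longrightarrow> d (f i) (f j) = j - i"
      unfolding n_def using geodesic_exists[OF x gx] by metis
    have n: "M + 2 * k + 1 < n" using g(2) n_def by simp
    have follow: "\<exists>j\<le>n. d (f i) (\<phi> h (f j)) \<le> L \<and> j \<le> i + C"
      if h: "h \<in> ?S" and i: "C + 2 * k < i" "i + C + 2 * k < n" for h i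
    proof -
      have hG: "h \<in> carrier G" and hx: "d x (\<phi> h x) \<le> C" using h A by auto
      \<comment> \<open>Since \<open>g\<close> and \<open>h\<close> commute, \<open>h\<close>
        displaces both ends of the geodesic equally.\<close>
      have "d (\<phi> g x) (\<phi> h (\<phi> g x)) = d x (\<phi> h x)"
        using composition_rule[OF x] gG hG A(2)[of g h] g h act_dist[OF gG x act_closed[OF hG x]]
        by (metis (mono_tags, lifting) mem_Collect_eq)
      then have hgx: "d (\<phi> g x) (\<phi> h (\<phi> g x)) \<le> C" using hx by simp
      have V: "\<phi> h (f j) \<in> V" if "j \<le> n" for j using act_closed[OF hG f(4)[OF that]] .
      \<comment> \<open>Discrete intermediate values: along the translated geodesic the distance
        from \<open>x\<close> changes by at most 1 per step, from at most \<open>C\<close> to at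
        least \<open>n - C\<close>.\<close>
      have "\<exists>j. 0 \<le> j \<and> j \<le> n \<and> int (d x (\<phi> h (f j))) = int i"
      proof (rule nat_intermed_int_val)
        show "\<forall>j. 0 \<le> j \<and> j < n \<longrightarrow> \<bar>int (d x (\<phi> h (f (Suc j)))) - int (d x (\<phi> h (f j)))\<bar> \<le> 1"
        proof (intro allI impI)
          fix j assume j: "0 \<le> j \<and> j < n"
          then have "adj (\<phi> h (f j)) (\<phi> h (f (Suc j)))" using act_adj[OF hG] f(3) by blast
          then show "\<bar>int (d x (\<phi> h (f (Suc j)))) - int (d x (\<phi> h (f j)))\<bar> \<le> 1"
            using dist_triangle[OF x V V, of j "Suc j"] dist_triangle[OF x V V, of "Suc j" j] j
              adj_dist[of "\<phi> h (f j)" "\<phi> h (f (Suc j))"] adj_dist[OF adj_sym, of "\<phi> h (f j)"]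
            by auto
        qed
        show "int (d x (\<phi> h (f 0))) \<le> int i" using hx i f(1) by simp
        have "n \<le> d x (\<phi> h (\<phi> g x)) + d (\<phi> h (\<phi> g x)) (\<phi> g x)"
          unfolding n_def using x gx act_closed[OF hG gx] by (intro dist_triangle)
        then show "int i \<le> int (d x (\<phi> h (f n)))"
          using i hgx dist_sym[OF gx act_closed[OF hG gx]] f(2) by simp
      qed simp
      then obtain j where j: "j \<le> n" "d x (\<phi> h (f j)) = i" by auto
      have dj: "d (\<phi> h x) (\<phi> h (f j)) = j"
        using act_dist[OF hG x f(4)[OF j(1)]] f(5)[of 0 j] f(1) j(1) by simp
      have "d (f i) (\<phi> h (f j)) \<le> 3 * k"
      proof (rule fellow_travel[OF hyp x gx act_closed[OF hG x] act_closed[OF hG gx] f(4) V[OF j(1)]])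
        show "d x (f i) + d (f i) (\<phi> g x) = d x (\<phi> g x)"
          using f(5)[of 0 i] f(5)[of i n] f(1,2) i n_def by simp
        show "d (\<phi> h x) (\<phi> h (f j)) + d (\<phi> h (f j)) (\<phi> h (\<phi> g x)) = d (\<phi> h x) (\<phi> h (\<phi> g x))"
          using dj act_dist[OF hG f(4)[OF j(1)] gx] act_dist[OF hG x gx] f(5)[of j n] f(2) j(1) n_def
          by simp
        show "d x (\<phi> h (f j)) = d x (f i)" "C + 2 * k < d x (f i)"
          using j(2) f(5)[of 0 i] f(1) i by auto
        show "C + 2 * k < d (f i) (\<phi> g x)" using f(5)[of i n] f(2) i by auto
      qed (use hx hgx i in auto)
      moreover have "j \<le> i + C"
        using dist_triangle[OF act_closed[OF hG x] x V[OF j(1)]] dj j(2) hx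
          dist_sym[OF x act_closed[OF hG x]] by simp
      ultimately show ?thesis using j(1) L_def by auto
    qed
    \<comment> \<open>The middle edge of the segment from \<open>f i0\<close> to
      \<open>f i1\<close>; \<open>u\<close> and \<open>w\<close> are at distance \<open>L\<close>
      from the respective ends.\<close>
    define u w where "u = f (i0 + L)" and "w = f (i0 + L + 1)"
    define X where "X = {z \<in> V. d (f i0) z \<le> L}"
    define Y where "Y = {z \<in> V. d (f i1) z \<le> L}"
    have fV: "f i0 \<in> V" "f i1 \<in> V" "u \<in> V" "w \<in> V"
      unfolding u_def w_def using n by (auto intro!: f(4) simp: M_def i1_def)
    have uw: "adj u w"
      unfolding u_def w_def using f(3)[of "i0 + L"] n by (simp add: M_def i1_def)
    have du: "d (f i0) u \<le> L" and dw: "d (f i1) w \<le> L"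
      using f(5)[of i0 "i0 + L"] f(5)[of "i0 + L + 1" i1] n dist_sym[OF fV(2,4)]
      unfolding u_def w_def by (auto simp: M_def i1_def)
    have XY: "X \<inter> Y = {}"
    proof -
      have "d (f i0) (f i1) = 2 * L + 1" using f(5)[of i0 i1] n by (simp add: M_def i1_def)
      then show ?thesis
        using dist_triangle[OF fV(1) _ fV(2)] dist_sym[OF fV(2)]
        unfolding X_def Y_def by fastforce
    qed
    \<comment> \<open>A walk goes inside \<open>X\<close> from \<open>u\<close> through
      \<open>f i0\<close> to \<open>h (f j0)\<close>, along the translated geodesic to
      \<open>h (f j1)\<close>, and inside \<open>Y\<close> through \<open>f i1\<close> to
      \<open>w\<close>. So some translated edge is near \<open>{u, w}\<close>.\<close>
    have hit: "\<exists>m<M. \<exists>e\<in>near_edges E N {u, w}. h \<in> transporter {f m, f (Suc m)} e"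
      if h: "h \<in> ?S" for h
    proof -
      have hG: "h \<in> carrier G" using h A by auto
      let ?B = "{\<phi> h ` {f m, f (Suc m)} | m. m < M}"
      define Q where
        "Q p q \<longleftrightarrow> adj p q \<and> ({p, q} \<subseteq> X \<or> {p, q} \<subseteq> Y \<or> {p, q} \<in> ?B)" for p q
      have Q_sym: "Q q p" if "Q p q" for p q
        using that unfolding Q_def by (simp add: insert_commute)
      obtain j0 where j0: "j0 \<le> n" "d (f i0) (\<phi> h (f j0)) \<le> L" "j0 \<le> i0 + C"
        using follow[OF h, of i0] n by (auto simp: i0_def M_def i1_def)
      obtain j1 where j1: "j1 \<le> n" "d (f i1) (\<phi> h (f j1)) \<le> L" "j1 \<le> i1 + C"
        using follow[OF h, of i1] n by (auto simp: i0_def M_def i1_def)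
      let ?z0 = "\<phi> h (f j0)" and ?z1 = "\<phi> h (f j1)"
      have z: "?z0 \<in> V" "?z1 \<in> V" using j0 j1 f(4) act_closed[OF hG] by auto
      have X: "reach Q L (f i0) p" if "p \<in> V" "d (f i0) p \<le> L" for p
        by (rule reach_mono[OF reach_in_ball[OF fV(1) that]]) (use edgeD in \<open>auto simp: X_def Q_def\<close>)
      have Y: "reach Q L (f i1) p" if "p \<in> V" "d (f i1) p \<le> L" for p
        by (rule reach_mono[OF reach_in_ball[OF fV(2) that]]) (use edgeD in \<open>auto simp: Y_def Q_def\<close>)
      have "d ?z0 ?z1 \<le> T"
        using dist_triangle[OF z(1) fV(1) z(2)] dist_triangle[OF fV(1,2) z(2)] j0(2) j1(2)
          dist_sym[OF z(1) fV(1)] f(5)[of i0 i1] n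
        by (simp add: M_def i1_def T_def)
      moreover have "d ?z0 ?z1 = (if j0 \<le> j1 then j1 - j0 else j0 - j1)"
        using act_dist[OF hG f(4)[OF j0(1)] f(4)[OF j1(1)]] f(5)[of j0 j1] f(5)[of j1 j0] j0(1) j1(1)
          dist_sym[OF f(4)[OF j0(1)] f(4)[OF j1(1)]] by auto
      ultimately have jT: "j0 \<le> j1 + T" "j1 \<le> j0 + T" by (auto split: if_splits)
      have mid: "reach Q T ?z0 ?z1"
      proof (rule reach_along[where f = "\<lambda>i. \<phi> h (f i)" and m = M and a = j0 and b = j1])
        fix i assume "i < M"
        moreover have "adj (\<phi> h (f i)) (\<phi> h (f (Suc i)))"
          using act_adj[OF hG f(3)[of i]] \<open>i < M\<close> n by simp
        moreover have "{\<phi> h (f i), \<phi> h (f (Suc i))} = \<phi> h ` {f i, f (Suc i)}" by simp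
        ultimately show "Q (\<phi> h (f i)) (\<phi> h (f (Suc i)))" unfolding Q_def by blast
      next
        show "j0 \<le> M" "j1 \<le> M" using j0(3) j1(3) by (auto simp: M_def i1_def)
      qed (fact Q_sym jT)+
      have "reach Q (L + (L + (T + (L + L)))) u w"
        using reach_trans[OF reach_sym[OF X[OF fV(3) du] Q_sym] reach_trans[OF X[OF z(1) j0(2)]
            reach_trans[OF mid reach_trans[OF reach_sym[OF Y[OF z(2) j1(2)] Q_sym] Y[OF fV(4) dw]]]]] .
      then have "\<exists>e\<in>?B. e \<in> near_edges E N {u, w}"
        unfolding N_def
        by (rule crossing_edge_near[OF uw _ _ XY, rotated 2]) (use fV du dw in \<open>auto simp: X_def Y_def Q_def\<close>)
      then show ?thesis using hG by auto
    qed
    \<comment> \<open>There are \<open>M\<close> edges, at most \<open>Nn\<close> images for each,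
      and at most \<open>Ns\<close> elements for each pair.\<close>
    let ?U = "\<Union>m<M. \<Union>e\<in>near_edges E N {u, w}. transporter {f m, f (Suc m)} e"
    have sub: "?S \<subseteq> ?U" using hit by fast
    have fin: "finite (near_edges E N {u, w})" by (rule finite_near_edges[OF fine uw])
    have edge: "{f m, f (Suc m)} \<in> E" if "m < M" for m using f(3) that n by simp
    have "finite ?U" using fin finite_transporter[OF edge] by blast
    moreover have "card ?U \<le> (\<Sum>m<M. Nn * Ns)"
    proof (rule order_trans[OF card_UN_le], simp, rule sum_mono)
      fix m assume "m \<in> {..<M}"
      then have "card (\<Union>e\<in>near_edges E N {u, w}. transporter {f m, f (Suc m)} e)
          \<le> (\<Sum>e\<in>near_edges E N {u, w}. Ns)"
        by (intro order_trans[OF card_UN_le[OF fin]] sum_mono Ns edge) auto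
      also have "\<dots> \<le> Nn * Ns" using Nn[OF uw] by simp
      finally show "card (\<Union>e\<in>near_edges E N {u, w}. transporter {f m, f (Suc m)} e) \<le> Nn * Ns" .
    qed
    moreover have "(\<Sum>m<M. Nn * Ns) \<le> K * Suc C"
    proof -
      have "M \<le> (2 * k + 2 * L + 2) * Suc C" by (simp add: M_def i1_def i0_def)
      then have "M * (Nn * Ns) \<le> (2 * k + 2 * L + 2) * Suc C * (Nn * Ns)" by (rule mult_le_mono1)
      then show ?thesis
        by (simp only: K_def sum_constant card_lessThan of_nat_id mult.assoc mult.commute mult.left_commute)
    qed
    ultimately show ?thesis
      using sub finite_subset[OF sub] card_mono[of ?U ?S] by linarith
  qed
  then show thesis using that by blast
qed

end

section \<open>Abelian subgroups of rank two\<close>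

context group
begin

lemma ord_int_pow_eq_0:
  assumes "x \<in> carrier G" "ord x = 0" "i \<noteq> 0"
  shows "ord (x [^] (i::int)) = 0"
  unfolding ord_eq_0[OF int_pow_closed[OF assms(1)]]
proof (intro allI impI)
  fix n :: nat assume "n \<noteq> 0"
  have "(x [^] i) [^] n = x [^] (i * int n)"
    using assms(1) by (simp add: int_pow_pow flip: int_pow_int)
  then show "(x [^] i) [^] n \<noteq> \<one>"
    using assms \<open>n \<noteq> 0\<close> by (simp add: int_pow_eq_id)
qed

lemma int_pow_commute:
  assumes "x \<in> carrier G"
  shows "x [^] (i::int) \<otimes> x = x \<otimes> x [^] i"
  using int_pow_mult[OF assms, of i 1] int_pow_mult[OF assms, of 1 i] assms
  by (simp add: add.commute)

lemma subgroup_generated_pair_commute: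
  assumes "x \<in> carrier G" "y \<in> carrier G" "comm_group (subgroup_generated G {x, y})"
  shows "x \<otimes> y = y \<otimes> x"
  using comm_groupE(4)[OF assms(3), of x y] subgroup_generated_subset_carrier_subset[of "{x, y}"] assms
  by simp

text \<open>\<open>a\<close> and \<open>b\<close> correspond to the two free generators, so
  coefficients recover exponents. Non-negative exponents already give quadratic growth.\<close>

lemma rank_two_pair:
  assumes A: "subgroup A G" and iso: "G\<lparr>carrier := A\<rparr> \<cong> free_Abelian_group {..<2::nat}"
  obtains a b where "a \<in> A" "b \<in> A" "inj (\<lambda>(i::nat, j::nat). a [^] i \<otimes> b [^] j)"
    "\<And>c. c \<in> A \<Longrightarrow> c \<noteq> \<one> \<Longrightarrow> ord c = 0"
proof -
  interpret A: subgroup A G by (rule A)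
  obtain \<psi> where \<psi>: "\<psi> \<in> iso (G\<lparr>carrier := A\<rparr>) (free_Abelian_group {..<2::nat})"
    using iso unfolding is_iso_def by blast
  have bij: "bij_betw \<psi> A (carrier (free_Abelian_group {..<2}))"
    using \<psi> unfolding iso_def by simp
  have mult: "\<psi> (g \<otimes> h) = \<psi> g + \<psi> h" if "g \<in> A" "h \<in> A" for g h
    using \<psi> that unfolding iso_def hom_def by simp
  have one: "\<psi> \<one> = 0"
    using mult[of \<one> \<one>] A.one_closed by simp
  have pow_closed: "c [^] n \<in> A" if "c \<in> A" for c and n :: nat
    using that by (induction n) auto
  have pow: "\<psi> (c [^] n) = frag_cmul (int n) (\<psi> c)" if "c \<in> A" for c and n :: nat
    using that by (induction n) (auto simp: one mult pow_closed frag_cmul_distrib add.commute)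
  have "\<exists>a\<in>A. \<psi> a = frag_of i" if "i < 2" for i :: nat
    using bij that unfolding bij_betw_def by (metis frag_of_in_free_Abelian_group imageE lessThan_iff)
  then obtain a b where ab: "a \<in> A" "\<psi> a = frag_of 0" "b \<in> A" "\<psi> b = frag_of 1"
    by (meson one_less_numeral_iff semiring_norm(76) zero_less_numeral)
  have "inj (\<lambda>(i::nat, j::nat). a [^] i \<otimes> b [^] j)"
  proof (rule injI, clarify)
    fix i j i' j' :: nat assume "a [^] i \<otimes> b [^] j = a [^] i' \<otimes> b [^] j'"
    then have "frag_cmul (int i) (frag_of 0) + frag_cmul (int j) (frag_of 1)
        = frag_cmul (int i') (frag_of (0::nat)) + frag_cmul (int j') (frag_of 1)"
      using mult pow ab pow_closed by metis
    then have "poly_mapping.lookup (frag_cmul (int i) (frag_of 0) + frag_cmul (int j) (frag_of 1)) l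
        = poly_mapping.lookup (frag_cmul (int i') (frag_of 0) + frag_cmul (int j') (frag_of 1)) l"
      for l :: nat by simp
    from this[of 0] this[of 1] show "i = i' \<and> j = j'" by (simp add: lookup_add)
  qed
  moreover have "ord c = 0" if c: "c \<in> A" "c \<noteq> \<one>" for c
    unfolding ord_eq_0[OF A.mem_carrier[OF c(1)]]
  proof (intro allI impI notI)
    fix n :: nat assume "n \<noteq> 0" "c [^] n = \<one>"
    then have "\<psi> c = 0" using pow[OF c(1), of n] one by simp
    then show False
      using c one A.one_closed bij unfolding bij_betw_def inj_on_def by metis
  qed
  ultimately show thesis using that ab(1,3) by blast
qed

end

section \<open>Quadratic against linear growth, and the spreading of fixed vertices\<close>

context fine_action
begin

lemma displacement_mult:
  assumes "g \<in> carrier G" "h \<in> carrier G" "x \<in> V"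
  shows "d x (\<phi> (g \<otimes> h) x) \<le> d x (\<phi> g x) + d x (\<phi> h x)"
  using dist_triangle[OF assms(3) act_closed act_closed, of g x "g \<otimes> h" x]
    act_dist[of g x "\<phi> h x"] composition_rule[of x g h] assms act_closed
  by simp

lemma displacement_pow:
  assumes "g \<in> carrier G" "x \<in> V"
  shows "d x (\<phi> (g [^] (n::nat)) x) \<le> n * d x (\<phi> g x)"
proof (induction n)
  case (Suc n)
  then show ?case
    using displacement_mult[OF nat_pow_closed[OF assms(1)] assms, of n] by simp
qed (simp add: act_one assms)

lemma rank_two_fixes_vertex:
  assumes hyp: "four_point k"
    and A: "subgroup A G" "\<And>g h. g \<in> A \<Longrightarrow> h \<in> A \<Longrightarrow> g \<otimes> h = h \<otimes> g"
    and ab: "a \<in> A" "b \<in> A" "inj (\<lambda>(i::nat, j::nat). a [^] i \<otimes> b [^] j)"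
  obtains c v where "c \<in> A" "c \<noteq> \<one>" "v \<in> V" "\<phi> c v = v"
proof (rule ccontr)
  assume "\<not> thesis"
  then have free: "c = \<one>" if "c \<in> A" "v \<in> V" "\<phi> c v = v" for c v
    using that(1,2,3) \<open>\<And>v c. \<lbrakk>c \<in> A; c \<noteq> \<one>; v \<in> V; \<phi> c v = v\<rbrakk> \<Longrightarrow> thesis\<close> by blast
  interpret A: subgroup A G by (rule A(1))
  let ?p = "\<lambda>(i::nat, j::nat). a [^] i \<otimes> b [^] j"
  have pow_closed: "c [^] n \<in> A" if "c \<in> A" for c and n :: nat
    using that by (induction n) auto
  have p_closed: "?p ij \<in> A" for ij
    using ab pow_closed by (auto split: prod.split)
  have fin: "finite {h \<in> A. \<phi> h p = q}" if p: "p \<in> V" for p q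
  proof -
    have "g = h" if "g \<in> A" "\<phi> g p = q" "h \<in> A" "\<phi> h p = q" for g h
    proof -
      have "\<phi> (inv g \<otimes> h) p = p"
        using that p act_inv(1)[of g p] composition_rule[of p "inv g" h] by simp
      then have "inv g \<otimes> h = \<one>" using free[of "inv g \<otimes> h" p] that p by simp
      moreover have "g \<otimes> (inv g \<otimes> h) = h" using that by (simp flip: m_assoc)
      ultimately show ?thesis using that by simp
    qed
    then have "{h \<in> A. \<phi> h p = q} = {} \<or> (\<exists>g. {h \<in> A. \<phi> h p = q} = {g})" by blast
    then show ?thesis by (elim disjE exE) (simp_all only: finite.emptyI finite.insertI)
  qed
  obtain x where x: "x \<in> V"
    using conn unfolding connected_graph_def by blast
  have proper: "finite {h \<in> A. d x (\<phi> h x) \<le> R}" for R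
  proof (rule ccontr)
    assume "infinite {h \<in> A. d x (\<phi> h x) \<le> R}"
    \<comment> \<open>Some vertex is fixed by everything that commutes with \<open>A\<close>, in
      particular by \<open>a\<close>.\<close>
    then obtain v where v: "v \<in> V"
        "\<And>g. g \<in> carrier G \<Longrightarrow> (\<And>h. h \<in> A \<Longrightarrow> g \<otimes> h = h \<otimes> g) \<Longrightarrow> \<phi> g v = v"
      using bounded_orbit_fixes[OF A.subset x _ fin] by blast
    then have "a = \<one>" using free ab(1) A(2) by simp
    then have "?p (0, 0) = ?p (1, 0)" by simp
    from injD[OF ab(3) this] show False by simp
  qed
  have "infinite (range ?p)"
    using finite_imageD[OF _ ab(3)] by (auto simp: finite_prod)
  then have "infinite A" using p_closed finite_subset[of "range ?p" A] by blast
  have unbounded: "\<exists>g\<in>A. R < d x (\<phi> g x)" for R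
  proof (rule ccontr)
    assume "\<not> ?thesis"
    then have "A \<subseteq> {h \<in> A. d x (\<phi> h x) \<le> R}" by (auto simp: not_less)
    then show False using proper \<open>infinite A\<close> finite_subset by blast
  qed
  obtain K where K: "\<And>C. card {h \<in> A. d x (\<phi> h x) \<le> C} \<le> K * Suc C"
    using linear_growth[OF hyp A.subset A(2) x unbounded] by blast
  define C where "C = d x (\<phi> a x) + d x (\<phi> b x)"
  \<comment> \<open>With this choice \<open>K * Suc (M * C)\<close> is at most
    \<open>Suc M * M\<close>, less than the number \<open>Suc M * Suc M\<close> of products.\<close>
  define M where "M = K * Suc C"
  have "?p ` ({..M} \<times> {..M}) \<subseteq> {h \<in> A. d x (\<phi> h x) \<le> M * C}"
  proof
    fix h assume "h \<in> ?p ` ({..M} \<times> {..M})"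
    then obtain i j where ij: "i \<le> M" "j \<le> M" "h = a [^] i \<otimes> b [^] j" by auto
    have "d x (\<phi> h x) \<le> i * d x (\<phi> a x) + j * d x (\<phi> b x)"
      using displacement_mult[of "a [^] i" "b [^] j" x] displacement_pow[of a x i]
        displacement_pow[of b x j] ij(3) ab x by simp
    also have "\<dots> \<le> M * C"
      unfolding C_def distrib_left using ij by (intro add_mono mult_le_mono1)
    finally show "h \<in> {h \<in> A. d x (\<phi> h x) \<le> M * C}" using ij(3) p_closed[of "(i, j)"] by simp
  qed
  then have "card (?p ` ({..M} \<times> {..M})) \<le> K * Suc (M * C)"
    using card_mono[OF proper] K order_trans by blast
  moreover have "card (?p ` ({..M} \<times> {..M})) = Suc M * Suc M"
    using card_image[OF inj_on_subset[OF ab(3) subset_UNIV], of "{..M} \<times> {..M}"]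
    by (simp add: card_cartesian_product)
  moreover have "K * Suc (M * C) \<le> Suc M * M"
  proof -
    have "Suc (M * C) \<le> Suc M * Suc C" by simp
    then have "K * Suc (M * C) \<le> K * (Suc M * Suc C)" by (rule mult_le_mono2)
    then show ?thesis by (simp only: M_def mult.assoc mult.commute mult.left_commute)
  qed
  ultimately have "Suc M * Suc M \<le> Suc M * M" by linarith
  then show False by simp
qed

lemma act_int_pow_fix:
  assumes "g \<in> carrier G" "v \<in> V" "\<phi> g v = v"
  shows "\<phi> (g [^] (i::int)) v = v"
  using subgroup_int_pow_closed[OF stabilizer_subgroup[OF assms(2)], of g i] assms
  unfolding stabilizer_def by simp

text \<open>\<open>g\<close> commutes with its power, which still has infinite order.\<close>

lemma fixed_of_int_pow_fixed:
  assumes "g \<in> carrier G" "ord g = 0" "i \<noteq> 0" "v \<in> V" "\<phi> (g [^] (i::int)) v = v"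
  shows "\<phi> g v = v"
  by (rule commuting_fixed[of "g [^] i"]) (use assms ord_int_pow_eq_0 int_pow_commute in auto)

text \<open>This carries a fixed vertex across an edge of the commutativity graph: from
  \<open>g\<close> to \<open>g [^] i\<close>, then to \<open>h [^] j\<close> and to
  \<open>h\<close>.\<close>

lemma commensurable_fixed:
  assumes g: "g \<in> carrier G" "ord g = 0" and h: "h \<in> carrier G" "ord h = 0"
    and ij: "i \<noteq> 0" "j \<noteq> 0" "g [^] (i::int) \<otimes> h [^] (j::int) = h [^] j \<otimes> g [^] i"
    and v: "v \<in> V" "\<phi> g v = v"
  shows "\<phi> h v = v"
proof (rule fixed_of_int_pow_fixed[OF h ij(2) v(1)])
  show "\<phi> (h [^] j) v = v"
    by (rule commuting_fixed[of "g [^] i"]) (use assms ord_int_pow_eq_0 act_int_pow_fix in auto)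
qed

text \<open>The powers of \<open>c\<close> carry \<open>e\<close> to infinitely many edges, all
  containing \<open>v\<close>.\<close>

lemma infinite_valence_if_fixed:
  assumes c: "c \<in> carrier G" "ord c = 0" and v: "v \<in> V" "\<phi> c v = v" and e: "e \<in> E" "v \<in> e"
  shows "infinite_valence E v"
proof -
  have "\<phi> (c [^] n) ` e \<in> {e \<in> E. v \<in> e}" for n :: nat
    using act_edge[of "c [^] n" e] act_pow_fix[OF c(1) v, of n] c e by (auto intro: rev_image_eqI)
  then have "range (\<lambda>n::nat. \<phi> (c [^] n) ` e) \<subseteq> {e \<in> E. v \<in> e}" by blast
  then show ?thesis
    unfolding infinite_valence_def using infinite_edge_orbit[OF c e(1)] finite_subset by blast
qed

end

section \<open>From a global fixed vertex to a contradiction\<close>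

lemma (in group) conjugate_eq_carrier:
  assumes "g \<in> carrier G" "subgroup L G" "g <# L #> inv g = carrier G"
  shows "L = carrier G"
proof
  show "L \<subseteq> carrier G" using assms(2) by (rule subgroup.subset)
  show "carrier G \<subseteq> L"
  proof
    fix x assume x: "x \<in> carrier G"
    then have "g \<otimes> x \<otimes> inv g \<in> g <# L #> inv g" using assms by simp
    then obtain l where l: "l \<in> L" "g \<otimes> x \<otimes> inv g = g \<otimes> l \<otimes> inv g"
      unfolding l_coset_def r_coset_def by auto
    moreover have "l \<in> carrier G" using l assms subgroup.subset by blast
    ultimately show "x \<in> L" using x assms(1) by simp
  qed
qed

theorem theorem2:
  fixes G :: "('a, 'b) monoid_scheme" (structure) and S :: "'a set"
    and s s' :: 'a and m n :: int
  assumes "group G"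
    and "\<exists>T. finite T \<and> generates G T (carrier G)"
    and "generates G S (carrier G)"
    and "infinite S \<or> 2 \<le> card S"
    and "\<forall>x\<in>S. group.ord G x = 0"
    and "connected_graph S (commutativity_edges G S)"
    and "{s, s'} \<in> commutativity_edges G S"
    and "m \<noteq> 0" and "n \<noteq> 0"
    and "comm_group (subgroup_generated G {s [^] m, s' [^] n})"
    and "has_rank (subgroup_generated G {s [^] m, s' [^] n}) 2"
  shows "\<not> (\<exists>\<L>. strongly_hyperbolic_relative TYPE('v) G \<L>)"
proof
  assume "\<exists>\<L>. strongly_hyperbolic_relative TYPE('v) G \<L>"
  then obtain \<L> where rel: "strongly_hyperbolic_relative TYPE('v) G \<L>" ..
  then have \<L>: "\<L> \<noteq> {}" "\<And>L. L \<in> \<L> \<Longrightarrow> subgroup L G" "\<And>L. L \<in> \<L> \<Longrightarrow> L \<noteq> carrier G"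
    unfolding strongly_hyperbolic_relative_def by simp_all
  from rel obtain V :: "'v set" and E \<phi> where
    act: "connected_graph V E" "acts_on_graph G V E \<phi>" "fine_graph E"
      "finite (orbits G E (edge_action \<phi>))"
      "\<forall>e\<in>E. finite (stabilizer G (edge_action \<phi>) e)"
    and hyp: "hyperbolic_graph V E"
    and stab: "{stabilizer G \<phi> v | v. v \<in> V \<and> infinite_valence E v} =
          {g <# L #> inv g | g L. g \<in> carrier G \<and> L \<in> \<L>}"
    unfolding strongly_hyperbolic_relative_def by (elim conjE exE) (rule that)
  interpret group G by fact
  interpret fine_action V E G \<phi>
    by unfold_locales (use act in auto)
  obtain k where k: "four_point k" using hyperbolic_imp_four_point[OF hyp] .
  have S: "S \<subseteq> carrier G" "generate G S = carrier G"
    using assms(3) unfolding generates_def by auto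
  have ord: "ord t = 0" if "t \<in> S" for t using assms(5) that by blast
  have sS: "s \<in> S" "s' \<in> S"
    using assms(7) unfolding commutativity_edges_def by (auto simp: doubleton_eq_iff)
  let ?A = "subgroup_generated G {s [^] m, s' [^] n}"
  obtain B where B: "subgroup B ?A" "?A\<lparr>carrier := B\<rparr> \<cong> free_Abelian_group {..<2::nat}"
    using assms(11) unfolding has_rank_def by blast
  then have BG: "subgroup B G" "B \<subseteq> carrier ?A"
    using subgroup_subgroup_generated_iff by auto
  have comm: "g \<otimes> h = h \<otimes> g" if "g \<in> carrier ?A" "h \<in> carrier ?A" for g h
    using comm_groupE(4)[OF assms(10) that] by simp
  have "G\<lparr>carrier := B\<rparr> \<cong> free_Abelian_group {..<2::nat}"
    using B(2) unfolding subgroup_generated_def by simp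
  then obtain a b where ab: "a \<in> B" "b \<in> B" "inj (\<lambda>(i::nat, j::nat). a [^] i \<otimes> b [^] j)"
      and torsion_free: "\<And>c. c \<in> B \<Longrightarrow> c \<noteq> \<one> \<Longrightarrow> ord c = 0"
    using rank_two_pair[OF BG(1)] by metis
  obtain c v where c: "c \<in> B" "c \<noteq> \<one>" and v: "v \<in> V" "\<phi> c v = v"
    using rank_two_fixes_vertex[OF k BG(1) _ ab] comm BG(2) by (metis subsetD)
  have smA: "s [^] m \<in> carrier ?A"
    using subgroup_generated_subset_carrier_subset[of "{s [^] m, s' [^] n}"] sS S(1) by auto
  \<comment> \<open>Both \<open>c\<close> and \<open>s [^] m\<close> lie in the abelian group
    \<open>?A\<close>, and \<open>c\<close> has infinite order.\<close>
  have "\<phi> (s [^] m) v = v"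
  proof (rule commuting_fixed[OF _ torsion_free[OF c] v])
    show "c \<in> carrier G" using c BG(1) subgroup.mem_carrier by metis
  qed (use c BG sS S(1) smA comm in auto)
  then have s: "\<phi> s v = v"
    by (rule fixed_of_int_pow_fixed[rotated 4]) (use sS S(1) ord assms(8) v(1) in auto)
  have fixed: "\<phi> t v = v" if t: "t \<in> S" for t
  proof -
    interpret K: conn_graph S "commutativity_edges G S" by unfold_locales fact
    have "(K.adj ^^ l) s t \<Longrightarrow> \<phi> t v = v" for l t
    proof (induction l arbitrary: t)
      case (Suc l)
      then obtain r where r: "\<phi> r v = v" "K.adj r t" by auto
      then have rt: "r \<in> S" "t \<in> S" using K.edgeD by auto
      obtain i j :: int where ij: "i \<noteq> 0" "j \<noteq> 0" "r [^] i \<otimes> t [^] j = t [^] j \<otimes> r [^] i"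
      proof -
        obtain p q and i j :: int where "{r, t} = {p, q}" "p \<in> S" "q \<in> S" "i \<noteq> 0" "j \<noteq> 0"
            "comm_group (subgroup_generated G {p [^] i, q [^] j})"
          using r(2) unfolding commutativity_edges_def by blast
        moreover from this have "p [^] i \<otimes> q [^] j = q [^] j \<otimes> p [^] i"
          using S(1) by (intro subgroup_generated_pair_commute) auto
        \<comment> \<open>Edges are unordered, so \<open>p\<close> and \<open>q\<close> may be
          \<open>r\<close> and \<open>t\<close> in either order.\<close>
        ultimately show thesis using that[of i j] that[of j i] by (auto simp: doubleton_eq_iff)
      qed
      show ?case
        by (rule commensurable_fixed[OF _ _ _ _ ij v(1) r(1)]) (use rt S(1) ord in auto)
    qed (use s in simp)
    then show ?thesis using K.dist_walk[OF sS(1) t] by blast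
  qed
  then have "S \<subseteq> stabilizer G \<phi> v" unfolding stabilizer_def using S(1) by auto
  then have "carrier G \<subseteq> stabilizer G \<phi> v"
    using generate_subgroup_incl[OF _ stabilizer_subgroup[OF v(1)], of S] S(2) by simp
  then have all: "stabilizer G \<phi> v = carrier G" using stabilizer_subset by blast
  \<comment> \<open>As \<open>\<L>\<close> is non-empty, some vertex \<open>u\<close> has infinite
    valence. If it is not \<open>v\<close>, connectedness gives an edge at \<open>v\<close>, and
    powers of \<open>s\<close> carry it to infinitely many edges at \<open>v\<close>.\<close>
  have "infinite_valence E v"
  proof -
    obtain L where "L \<in> \<L>" using \<L>(1) by blast
    then have "\<one> <# L #> inv \<one> \<in> {stabilizer G \<phi> v | v. v \<in> V \<and> infinite_valence E v}"
      unfolding stab by blast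
    then obtain u where u: "u \<in> V" "infinite_valence E u" by blast
    show ?thesis
    proof (cases "u = v")
      case False
      then obtain w where "adj v w" using first_step[OF u(1) v(1)] by blast
      then show ?thesis
        using infinite_valence_if_fixed[of s v "{v, w}"] sS S(1) ord v(1) s by auto
    qed (use u in simp)
  qed
  then have "stabilizer G \<phi> v \<in> {stabilizer G \<phi> v | v. v \<in> V \<and> infinite_valence E v}"
    using v(1) by blast
  \<comment> \<open>Now \<open>G\<close> is a conjugate of some \<open>L\<close> in
    \<open>\<L>\<close>, which forces \<open>L\<close> to be all of \<open>G\<close>, although it is
    proper.\<close>
  then have "carrier G \<in> {g <# L #> inv g | g L. g \<in> carrier G \<and> L \<in> \<L>}"
    unfolding stab all .
  then obtain g L where "g \<in> carrier G" "L \<in> \<L>" "g <# L #> inv g = carrier G" by auto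
  then show False using conjugate_eq_carrier \<L>(2,3) by metis
qed

end
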